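(* The quaternary quadratic form $Q_{34}^3=x^2+2y^2+4z^2+6w^2+4zw+2yz$ (Gram matrix $\begin{pmatrix}1&0&0&0\\0&2&1&0\\0&1&4&2\\0&0&2&6\end{pmatrix}$) is primitively universal.
   Context: A quadratic form $f$ in variables $x,y,z,w$ is primitively universal if for every positive integer $n$ the equation $f(x,y,z,w)=n$ has an integer solution with $\gcd(x,y,z,w)=1$. *)

theory Defs
  imports Main
begin

definition primitively_universal :: "(int \<Rightarrow> int \<Rightarrow> int \<Rightarrow> int \<Rightarrow> int) \<Rightarrow> bool" where
  "primitively_universal f \<longleftrightarrow>
     (\<forall>n>0. \<exists>x y z w. f x y z w = n \<and> Gcd {x, y, z, w} = 1)"

definition Q34_3 :: "int \<Rightarrow> int \<Rightarrow> int \<Rightarrow> int \<Rightarrow> int" where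
  "Q34_3 x y z w = x^2 + 2 * y^2 + 4 * z^2 + 6 * w^2 + 4 * z * w + 2 * y * z"

definition Q34_3_gram :: "int list list" where
  "Q34_3_gram =
    [[1, 0, 0, 0],
     [0, 2, 1, 0],
     [0, 1, 4, 2],
     [0, 0, 2, 6]]"

lemma Q34_3_eq_gram:
  "Q34_3 x y z w =
     (\<Sum>i<4. \<Sum>j<4. [x, y, z, w] ! i * Q34_3_gram ! i ! j * [x, y, z, w] ! j)"
  by (simp add: Q34_3_def Q34_3_gram_def eval_nat_numeral lessThan_Suc algebra_simps)

end

theory Submission
  imports Defs "HOL-Analysis.Analysis" "HOL-Number_Theory.Number_Theory" "HOL-Real_Asymp.Real_Asymp"
begin

text \<open>
  For \<open>n \<ge> 4\<close> a representation with \<open>z = 1\<close> is sought. Completing squares, this amounts to writing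
  \<open>m = 6 n - 17\<close> as \<open>6 X\<^sup>2 + 3 Y\<^sup>2 + 4 Z\<^sup>2\<close>. The form \<open>Z\<^sup>2 + 3 Y\<^sup>2 + 6 x\<^sup>2\<close> is half of the restriction
  of the sum of three squares to the span of \<open>(1, -1, 0)\<close>, \<open>(1, 1, -2)\<close>, \<open>(2, 2, 2)\<close>, so a primitive
  representation of \<open>2 m\<close> as a sum of three squares gives \<open>m = Z\<^sup>2 + 3 Y\<^sup>2 + 6 x\<^sup>2\<close> with
  \<open>(Y, x) \<noteq> (0, 0)\<close>. If \<open>Z\<close> is odd, the reflection in the vector \<open>(3, 1, 1)\<close> of norm 18 makes it even;
  it is integral at \<open>(Z, Y, x)\<close>, up to signs, once \<open>Y\<close> and \<open>x\<close> are not both divisible by 3, which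
  multiplication by powers of \<open>(1 + \<surd>-2) / (1 - \<surd>-2)\<close> in the plane of \<open>Y\<close> and \<open>x\<close> achieves.

  For the three squares, a prime \<open>q \<equiv> 3 (mod 8)\<close> such that \<open>-q\<close> is a quadratic residue modulo every
  prime factor of \<open>m\<close> yields a positive definite integral ternary form of determinant 1 with leading
  coefficient \<open>2 m\<close>, and every such form is equivalent to the sum of three squares. The conditions on
  \<open>q\<close> only involve real characters, so its existence follows from Dirichlet's argument restricted to
  these characters: \<open>\<Sum>\<psi>(p) p\<^sup>-\<^sup>s\<close> stays bounded as \<open>s \<rightarrow> 1\<close> for nonprincipal real \<open>\<psi>\<close>.
\<close>

section \<open>Euler products\<close>

text \<open>Induction on \<open>P\<close>: the integers free of primes in \<open>P\<close> split
  into those also prime to \<open>q\<close> and \<open>q\<close> times all of them. By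
  multiplicativity the second part contributes \<open>f q\<close> times the whole sum.\<close>

lemma infsum_sieve:
  fixes f :: "nat \<Rightarrow> real"
  assumes mult: "\<And>m n. f (m * n) = f m * f n"
    and summ: "f summable_on UNIV"
    and P: "finite P" "\<And>p. p \<in> P \<Longrightarrow> prime p"
  shows "(\<Prod>p\<in>P. 1 - f p) * infsum f UNIV = infsum f {n. \<forall>p\<in>P. \<not> p dvd n}"
  using P
proof (induction P rule: finite_induct)
  case (insert q P)
  have sub: "f summable_on A" for A
    using summ summable_on_subset_banach by blast
  have q: "prime q" using insert.prems by simp
  have "p dvd q * n \<longleftrightarrow> p dvd n" if "p \<in> P" for p n
    using insert.prems[of p] insert.hyps that q primes_dvd_imp_eq[of p q]
    by (auto simp: prime_dvd_mult_iff)
  hence qP: "(\<forall>p\<in>P. \<not> p dvd q * n) \<longleftrightarrow> (\<forall>p\<in>P. \<not> p dvd n)" for n by simp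
  have "inj ((*) q)" using q by (auto simp: inj_on_def)
  hence inj: "inj_on ((*) q) A" for A using inj_on_subset by blast
  define A where "A = {n. \<forall>p\<in>P. \<not> p dvd n}"
  define B where "B = {n. \<forall>p\<in>insert q P. \<not> p dvd n}"
  have disj: "B \<inter> (*) q ` A = {}" unfolding B_def by auto
  have AB: "A = B \<union> (*) q ` A"
  proof (intro equalityI subsetI)
    fix n assume n: "n \<in> A"
    show "n \<in> B \<union> (*) q ` A"
    proof (cases "q dvd n")
      case True
      then obtain k where k: "n = q * k" by (elim dvdE)
      hence "k \<in> A" using n qP[of k] unfolding A_def by simp
      thus ?thesis using k by blast
    qed (use n in \<open>simp add: A_def B_def\<close>)
  next
    fix n assume "n \<in> B \<union> (*) q ` A"
    thus "n \<in> A" unfolding A_def B_def using qP by auto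
  qed
  have "infsum f A = infsum f B + infsum f ((*) q ` A)"
    by (subst AB) (rule infsum_Un_disjoint[OF sub sub disj])
  also have "infsum f ((*) q ` A) = infsum (\<lambda>n. f q * f n) A"
    by (subst infsum_reindex[OF inj]) (simp add: o_def mult)
  also have "\<dots> = f q * infsum f A" by (rule infsum_cmult_right')
  finally have "infsum f B = (1 - f q) * infsum f A" unfolding left_diff_distrib by linarith
  moreover have "(\<Prod>p\<in>P. 1 - f p) * infsum f UNIV = infsum f A"
    using insert.IH insert.prems unfolding A_def by simp
  ultimately show ?case using insert.hyps unfolding B_def by (simp add: mult.assoc)
qed simp

text \<open>Apart from 0 and 1, where \<open>f\<close> is known, a survivor of the sieve has only
  prime factors above \<open>x\<close>, so it exceeds \<open>x\<close> and belongs to the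
  tail.\<close>

lemma norm_sieved_infsum_le:
  fixes f :: "nat \<Rightarrow> real"
  assumes f01: "f 0 = 0" "f 1 = 1" and summ: "summable (\<lambda>n. \<bar>f n\<bar>)"
  shows "\<bar>infsum f {n. \<forall>p. prime p \<and> p \<le> x \<longrightarrow> \<not> p dvd n} - 1\<bar> \<le> (\<Sum>n. \<bar>f (n + Suc x)\<bar>)"
proof -
  define A where "A = {n. \<forall>p. prime p \<and> p \<le> x \<longrightarrow> \<not> p dvd n}"
  define B where "B = A - {0, 1}"
  have abs: "(\<lambda>n. \<bar>f n\<bar>) summable_on C" for C
    using norm_summable_imp_summable_on[of "\<lambda>n. \<bar>f n\<bar>"] summ summable_on_subset_banach by fastforce
  have sub: "f summable_on C" for C
    using abs_summable_summable[of f C] abs by simp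
  \<comment> \<open>0 lies in \<open>A\<close> only if there is no prime up to \<open>x\<close>;
    \<open>f 0 = 0\<close> covers this case.\<close>
  have "infsum f A = infsum f (insert 1 B)"
    by (rule infsum_cong_neutral) (auto simp: A_def B_def f01 simp del: One_nat_def)
  also have "\<dots> = 1 + infsum f B" by (subst infsum_insert) (auto simp: B_def sub f01 simp del: One_nat_def)
  finally have "\<bar>infsum f A - 1\<bar> = \<bar>infsum f B\<bar>" by simp
  also have "\<dots> \<le> infsum (\<lambda>n. \<bar>f n\<bar>) B" using norm_infsum_bound[of f B] abs by simp
  also have "\<dots> \<le> infsum (\<lambda>n. \<bar>f n\<bar>) ((\<lambda>n. n + Suc x) ` UNIV)"
  proof (rule infsum_mono_neutral[OF abs abs])
    fix n assume n: "n \<in> B - range (\<lambda>n. n + Suc x)"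
    hence "n \<noteq> 1" "n \<noteq> 0" unfolding B_def by auto
    then obtain p where p: "prime p" "p dvd n" using prime_factor_nat by blast
    have "n \<le> x" using n by (metis DiffD2 le_add_diff_inverse2 not_less_eq_eq rangeI)
    moreover have "p \<le> n" using p(2) \<open>n \<noteq> 0\<close> by (simp add: dvd_imp_le)
    ultimately have "p \<le> x" by simp
    moreover have "n \<in> A" using n B_def by simp
    ultimately show "\<bar>f n\<bar> \<le> 0" using p unfolding A_def by simp
  qed auto
  also have "\<dots> = infsum (\<lambda>n. \<bar>f (n + Suc x)\<bar>) UNIV"
    by (subst infsum_reindex) (auto simp: o_def inj_on_def)
  also have "\<dots> = (\<Sum>n. \<bar>f (n + Suc x)\<bar>)"
  proof (rule infsumI, rule norm_summable_imp_has_sum)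
    show "summable (\<lambda>n. norm \<bar>f (n + Suc x)\<bar>)" using summable_ignore_initial_segment[OF summ, of "Suc x"] by simp
    thus "(\<lambda>n. \<bar>f (n + Suc x)\<bar>) sums (\<Sum>n. \<bar>f (n + Suc x)\<bar>)"
      by (intro summable_sums) simp
  qed
  finally show ?thesis unfolding A_def .
qed

text \<open>The Euler product without infinite products or division. The limit being 1 also shows
  that the sum is nonzero.\<close>

lemma euler_product_tendsto_1:
  fixes f :: "nat \<Rightarrow> real"
  assumes mult: "\<And>m n. f (m * n) = f m * f n" and f01: "f 0 = 0" "f 1 = 1"
    and summ: "summable (\<lambda>n. \<bar>f n\<bar>)"
  shows "(\<lambda>x. (\<Prod>p | prime p \<and> p \<le> x. 1 - f p) * suminf f) \<longlonglongrightarrow> 1"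
proof -
  have inf: "f summable_on UNIV" using norm_summable_imp_summable_on[of f] summ by simp
  have "(f has_sum suminf f) UNIV"
    using norm_summable_imp_has_sum[of f] summ summable_rabs_cancel summable_sums by auto
  hence "infsum f UNIV = suminf f" by (rule infsumI)
  note suminf_eq = this
  have *: "(\<Prod>p | prime p \<and> p \<le> x. 1 - f p) * suminf f =
        infsum f {n. \<forall>p. prime p \<and> p \<le> x \<longrightarrow> \<not> p dvd n}" for x
  proof -
    have "(\<Prod>p | prime p \<and> p \<le> x. 1 - f p) * infsum f UNIV =
        infsum f {n. \<forall>p\<in>{p. prime p \<and> p \<le> x}. \<not> p dvd n}"
      by (rule infsum_sieve[OF mult inf]) auto
    thus ?thesis by (simp only: Ball_def mem_Collect_eq suminf_eq)
  qed
  have "(\<lambda>x. \<Sum>n. \<bar>f (n + Suc x)\<bar>) \<longlonglongrightarrow> 0"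
  proof (rule LIMSEQ_I)
    fix r :: real assume "r > 0"
    then obtain N where N: "\<And>n. n \<ge> N \<Longrightarrow> norm (\<Sum>i. \<bar>f (i + n)\<bar>) < r"
      using suminf_exist_split[OF _ summ, of r] by auto
    thus "\<exists>no. \<forall>n\<ge>no. norm ((\<Sum>i. \<bar>f (i + Suc n)\<bar>) - 0) < r"
      using N[of "Suc _"] by (intro exI[of _ N]) (simp del: add_Suc_right)
  qed
  hence "(\<lambda>x. infsum f {n. \<forall>p. prime p \<and> p \<le> x \<longrightarrow> \<not> p dvd n} - 1) \<longlonglongrightarrow> 0"
    by (rule Lim_null_comparison[rotated]) (use norm_sieved_infsum_le[OF f01 summ] in auto)
  thus ?thesis unfolding * by (simp add: LIM_zero_iff)
qed

section \<open>Real characters and their L-functions\<close>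

text \<open>The constant 1 is included, so that the zeta function falls under the same lemmas;
  periods enter only with \<open>nonprincipal_character\<close>.\<close>

locale real_character =
  fixes \<psi> :: "nat \<Rightarrow> real"
  assumes one: "\<psi> 1 = 1"
    and mult: "\<psi> (m * n) = \<psi> m * \<psi> n"
    and range: "\<psi> n \<in> {-1, 0, 1}"
begin

text \<open>Since \<open>0 powr - s = 0\<close>, the index 0 contributes nothing and sums may run
  over all natural numbers.\<close>

definition dirichlet_term :: "real \<Rightarrow> nat \<Rightarrow> real" where
  "dirichlet_term s n = \<psi> n * real n powr - s"

definition L :: "real \<Rightarrow> real" where
  "L s = (\<Sum>n. dirichlet_term s n)"

definition prime_sum :: "real \<Rightarrow> real" where
  "prime_sum s = (\<Sum>n. if prime n then dirichlet_term s n else 0)"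

lemma abs_le_one: "\<bar>\<psi> n\<bar> \<le> 1"
  using range[of n] by auto

lemma abs_dirichlet_term_le: "\<bar>dirichlet_term s n\<bar> \<le> real n powr - s"
  unfolding dirichlet_term_def using mult_right_mono[OF abs_le_one[of n], of "real n powr - s"] by (simp add: abs_mult)

lemma dirichlet_term_mult: "dirichlet_term s (m * n) = dirichlet_term s m * dirichlet_term s n"
  unfolding dirichlet_term_def by (simp add: mult powr_mult)

lemma dirichlet_term_0 [simp]: "dirichlet_term s 0 = 0"
  by (simp add: dirichlet_term_def)

lemma dirichlet_term_1 [simp]: "dirichlet_term s 1 = 1" "dirichlet_term s (Suc 0) = 1"
  using one by (simp_all add: dirichlet_term_def)

lemma summable_abs_dirichlet_term:
  assumes "s > 1"
  shows "summable (\<lambda>n. \<bar>dirichlet_term s n\<bar>)"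
proof (rule summable_comparison_test')
  show "summable (\<lambda>n. real n powr - s)" using assms by (subst summable_real_powr_iff) simp
qed (simp add: abs_dirichlet_term_le)

lemma summable_prime_terms:
  assumes "s > 1"
  shows "summable (\<lambda>n. if prime n then dirichlet_term s n else 0)"
  by (rule summable_comparison_test'[OF summable_abs_dirichlet_term[OF assms]]) simp

text \<open>Logarithm of the Euler product: each prime leaves an error \<open>t + ln (1 - t)\<close>
  with \<open>\<bar>t\<bar> \<le> 1 / 2\<close>, which is quadratic in \<open>t\<close>. The
  resulting bound is independent of \<open>s\<close>, so \<open>prime_sum\<close> and
  \<open>ln L\<close> are bounded or unbounded together as \<open>s\<close> tends to 1.\<close>

lemma log_euler_product:
  assumes s: "s > 1"
  shows "L s > 0" and "\<bar>prime_sum s - ln (L s)\<bar> \<le> 2 * (\<Sum>n. 1 / real n ^ 2)"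
proof -
  define P where "P x = (\<Prod>p | prime p \<and> p \<le> x. 1 - dirichlet_term s p)" for x :: nat
  define T where "T x = (\<Sum>n\<le>x. if prime n then dirichlet_term s n else 0)" for x :: nat
  define K where "K = (\<Sum>n. 1 / real n ^ 2)"
  have summK: "summable (\<lambda>n. 1 / real n ^ 2)"
    using inverse_power_summable[of 2, where 'a = real] by (simp add: field_simps)
  have half: "\<bar>dirichlet_term s p\<bar> \<le> 1 / 2" and sq: "(dirichlet_term s p)\<^sup>2 \<le> 1 / real p ^ 2" if "prime p" for p
  proof -
    have p: "real p \<ge> 2" using prime_ge_2_nat[OF that] by simp
    have "\<bar>dirichlet_term s p\<bar> \<le> real p powr - s" by (rule abs_dirichlet_term_le)
    also have "\<dots> \<le> real p powr - 1" using p s by (intro powr_mono) auto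
    also have "\<dots> = 1 / real p" using p by (simp add: powr_minus_divide)
    finally have *: "\<bar>dirichlet_term s p\<bar> \<le> 1 / real p" .
    also have "\<dots> \<le> 1 / 2" using p by (simp add: field_simps)
    finally show "\<bar>dirichlet_term s p\<bar> \<le> 1 / 2" .
    show "(dirichlet_term s p)\<^sup>2 \<le> 1 / real p ^ 2"
      using power_mono[OF *, of 2] by (simp add: power_divide)
  qed
  have factor_pos: "1 - dirichlet_term s p > 0" if "prime p" for p
    using half[OF that] by linarith
  have factor_ne: "dirichlet_term s p \<noteq> 1" if "prime p" for p
    using factor_pos[OF that] by simp
  have P_pos: "P x > 0" for x
    unfolding P_def using factor_pos by (intro prod_pos) simp
  have lim: "(\<lambda>x. P x * L s) \<longlonglongrightarrow> 1"
    unfolding P_def L_def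
    by (rule euler_product_tendsto_1) (auto simp: dirichlet_term_mult summable_abs_dirichlet_term s)
  \<comment> \<open>The partial products are positive, so a negative \<open>L s\<close> would keep
    \<open>P x * L s\<close> away from 1.\<close>
  have "L s \<ge> 0"
  proof (rule ccontr)
    assume "\<not> L s \<ge> 0"
    hence "P x * L s \<le> 0" for x using P_pos[of x] by (simp add: mult_le_0_iff)
    hence "(1 :: real) \<le> 0" using lim by (intro LIMSEQ_le_const2) auto
    thus False by simp
  qed
  moreover have "L s \<noteq> 0" using lim by (auto simp: LIMSEQ_const_iff)
  ultimately show pos: "L s > 0" by simp
  have "(\<lambda>x. ln (P x * L s)) \<longlonglongrightarrow> ln 1"
    using lim by (intro tendsto_ln) auto
  moreover have "P x \<noteq> 0" for x using P_pos[of x] by simp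
  ultimately have "(\<lambda>x. ln (P x) + ln (L s)) \<longlonglongrightarrow> 0"
    using pos by (simp add: ln_mult)
  moreover have "T \<longlonglongrightarrow> prime_sum s"
    unfolding T_def prime_sum_def by (rule summable_LIMSEQ'[OF summable_prime_terms[OF s]])
  ultimately have "(\<lambda>x. T x + ln (P x)) \<longlonglongrightarrow> prime_sum s - ln (L s)"
    using tendsto_diff[OF tendsto_add tendsto_const[of "ln (L s)"], of T "prime_sum s" sequentially
        "\<lambda>x. ln (P x) + ln (L s)" 0]
    by (simp add: add.assoc[symmetric])
  hence lim2: "(\<lambda>x. \<bar>T x + ln (P x)\<bar>) \<longlonglongrightarrow> \<bar>prime_sum s - ln (L s)\<bar>"
    by (rule tendsto_rabs)
  have "\<bar>T x + ln (P x)\<bar> \<le> 2 * K" for x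
  proof -
    have "T x = (\<Sum>p | prime p \<and> p \<le> x. dirichlet_term s p)"
      unfolding T_def by (intro sum.mono_neutral_cong_right) auto
    moreover have "ln (P x) = (\<Sum>p | prime p \<and> p \<le> x. ln (1 - dirichlet_term s p))"
      unfolding P_def using factor_ne by (intro ln_prod) auto
    ultimately have "T x + ln (P x) = (\<Sum>p | prime p \<and> p \<le> x. dirichlet_term s p + ln (1 - dirichlet_term s p))"
      by (simp add: sum.distrib)
    also have "\<bar>\<dots>\<bar> \<le> (\<Sum>p | prime p \<and> p \<le> x. \<bar>dirichlet_term s p + ln (1 - dirichlet_term s p)\<bar>)"
      by (rule sum_abs)
    also have "\<dots> \<le> (\<Sum>p | prime p \<and> p \<le> x. 2 * (1 / real p ^ 2))"
    proof (rule sum_mono)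
      fix p assume "p \<in> {p. prime p \<and> p \<le> x}"
      hence p: "prime p" by simp
      have "\<bar>ln (1 + (- dirichlet_term s p)) - (- dirichlet_term s p)\<bar> \<le> 2 * (- dirichlet_term s p)\<^sup>2"
        using half[OF p] by (intro abs_ln_one_plus_x_minus_x_bound) simp
      thus "\<bar>dirichlet_term s p + ln (1 - dirichlet_term s p)\<bar> \<le> 2 * (1 / real p ^ 2)"
        using sq[OF p] by (simp add: add.commute)
    qed
    also have "\<dots> \<le> (\<Sum>p\<le>x. 2 * (1 / real p ^ 2))"
      by (intro sum_mono2) auto
    also have "\<dots> = 2 * (\<Sum>p\<le>x. 1 / real p ^ 2)" by (simp add: sum_distrib_left)
    also have "(\<Sum>p\<le>x. 1 / real p ^ 2) \<le> K"
      unfolding K_def by (intro sum_le_suminf summK) auto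
    finally show ?thesis by simp
  qed
  thus "\<bar>prime_sum s - ln (L s)\<bar> \<le> 2 * (\<Sum>n. 1 / real n ^ 2)"
    using lim2 unfolding K_def[symmetric] by (intro LIMSEQ_le_const2) auto
qed

end

lemma real_character_one: "real_character (\<lambda>_. 1)"
  by unfold_locales auto

text \<open>Summation by parts. The partial sums \<open>C\<close> are counted from \<open>m\<close>,
  hence bounded by \<open>2 * B\<close>, and the differences of \<open>b\<close> telescope.\<close>

lemma abs_sum_antimono_le:
  fixes b c :: "nat \<Rightarrow> real"
  assumes bounded: "\<And>k. \<bar>\<Sum>i<k. c i\<bar> \<le> B"
    and decr: "\<And>k. m \<le> k \<Longrightarrow> b (Suc k) \<le> b k" and nonneg: "\<And>k. m \<le> k \<Longrightarrow> b k \<ge> 0"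
  shows "\<bar>\<Sum>k=m..<n. c k * b k\<bar> \<le> 2 * B * b m"
proof (cases "m \<le> n")
  case True
  define C where "C k = (\<Sum>i<k. c i) - (\<Sum>i<m. c i)" for k
  have C: "\<bar>C k\<bar> \<le> 2 * B" for k
    using bounded[of k] bounded[of m] unfolding C_def by linarith
  have "B \<ge> 0" using bounded[of 0] by simp
  have "(\<Sum>k=m..<n. c k * b k) = (\<Sum>k=m..<n. C (Suc k) * (b k - b (Suc k))) + C n * b n"
    using True by (induction n rule: dec_induct) (auto simp: C_def algebra_simps)
  also have "\<bar>\<dots>\<bar> \<le> \<bar>\<Sum>k=m..<n. C (Suc k) * (b k - b (Suc k))\<bar> + \<bar>C n * b n\<bar>"
    by (rule abs_triangle_ineq)
  also have "\<dots> \<le> (\<Sum>k=m..<n. \<bar>C (Suc k) * (b k - b (Suc k))\<bar>) + \<bar>C n * b n\<bar>"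
    by (intro add_right_mono sum_abs)
  also have "\<dots> \<le> (\<Sum>k=m..<n. 2 * B * (b k - b (Suc k))) + 2 * B * b n"
  proof (intro add_mono sum_mono)
    fix k assume "k \<in> {m..<n}"
    thus "\<bar>C (Suc k) * (b k - b (Suc k))\<bar> \<le> 2 * B * (b k - b (Suc k))"
      using decr[of k] mult_right_mono[OF C[of "Suc k"], of "b k - b (Suc k)"]
      by (simp add: abs_mult)
  next
    show "\<bar>C n * b n\<bar> \<le> 2 * B * b n"
      using nonneg[OF True] mult_right_mono[OF C[of n], of "b n"] by (simp add: abs_mult)
  qed
  also have "(\<Sum>k=m..<n. 2 * B * (b k - b (Suc k))) = 2 * B * (b m - b n)"
    using True by (simp add: sum_distrib_left[symmetric] sum_Suc_diff'[of m n "\<lambda>k. - b k", simplified])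
  finally show ?thesis by (simp add: algebra_simps)
next
  case False
  have "B \<ge> 0" using bounded[of 0] by simp
  thus ?thesis using False nonneg[of m] by simp
qed

section \<open>Convergence and continuity of L-functions of nonprincipal characters down to s =
  1\<close>

lemma periodic_mod:
  fixes f :: "nat \<Rightarrow> 'a"
  assumes "\<And>n. f (n + N) = f n"
  shows "f (n mod N) = f n"
proof -
  have "f (m + k * N) = f m" for m k
  proof (induction k)
    case (Suc k)
    thus ?case using assms[of "m + k * N"] by (simp add: add_ac)
  qed simp
  from this[of "n mod N" "n div N"] show ?thesis by simp
qed

text \<open>Being nonprincipal is expressed by a witness \<open>a\<close>, prime to the period
  \<open>N\<close>, with value -1.\<close>

locale nonprincipal_character = real_character +
  fixes N a :: nat
  assumes period: "\<psi> (n + N) = \<psi> n"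
    and coprime: "coprime a N" and neg: "\<psi> a = -1"
begin

lemma N_pos: "N > 0"
  using coprime neg one by (cases "N = 0") auto

lemma at_mod: "\<psi> (n mod N) = \<psi> n"
  using period by (rule periodic_mod)

text \<open>Multiplication by \<open>a\<close> permutes the residues modulo \<open>N\<close> and
  changes the sign of every value, so the sum equals its own negative.\<close>

lemma sum_period: "(\<Sum>n<N. \<psi> n) = 0"
proof -
  have inj: "inj_on (\<lambda>n. a * n mod N) {..<N}"
  proof (rule inj_onI)
    fix x y assume xy: "x \<in> {..<N}" "y \<in> {..<N}" "a * x mod N = a * y mod N"
    hence "[x = y] (mod N)" using cong_mult_lcancel_nat[OF coprime, of x y] by (simp add: cong_def)
    thus "x = y" using xy by (simp add: cong_def)
  qed
  moreover have "(\<lambda>n. a * n mod N) ` {..<N} \<subseteq> {..<N}" using N_pos by auto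
  ultimately have "bij_betw (\<lambda>n. a * n mod N) {..<N} {..<N}"
    using endo_inj_surj[of "{..<N}"] by (simp add: bij_betw_def)
  hence "(\<Sum>n<N. \<psi> n) = (\<Sum>n<N. \<psi> (a * n mod N))"
    by (rule sum.reindex_bij_betw[symmetric])
  also have "\<dots> = - (\<Sum>n<N. \<psi> n)" by (simp add: at_mod mult neg sum_negf)
  finally show ?thesis by simp
qed

lemma abs_partial_sum_le: "\<bar>\<Sum>n<M. \<psi> n\<bar> \<le> real N"
proof (induction M rule: less_induct)
  case (less M)
  show ?case
  proof (cases "M < N")
    case True
    have "\<bar>\<Sum>n<M. \<psi> n\<bar> \<le> (\<Sum>n<M. 1)"
      by (rule order_trans[OF sum_abs]) (intro sum_mono abs_le_one)
    thus ?thesis using True by simp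
  next
    case False
    then obtain K where K: "M = K + N" by (metis add.commute le_Suc_ex not_less)
    have "(\<Sum>n<K + N. \<psi> n) = (\<Sum>n<N. \<psi> n) + (\<Sum>n<K. \<psi> (n + N))"
      by (induction K) simp_all
    hence "(\<Sum>n<M. \<psi> n) = (\<Sum>n<K. \<psi> n)" unfolding K by (simp add: sum_period period)
    thus ?thesis using less.IH[of K] K N_pos by simp
  qed
qed

text \<open>The bound is the same for all \<open>s \<ge> 1\<close>; this yields convergence at
  \<open>s = 1\<close> and uniform convergence on \<open>{1..}\<close>.\<close>

lemma abs_segment_le:
  assumes "s \<ge> 1" "m > 0"
  shows "\<bar>\<Sum>k=m..<n. dirichlet_term s k\<bar> \<le> 2 * real N / real m"
proof -
  have "\<bar>\<Sum>k=m..<n. dirichlet_term s k\<bar> \<le> 2 * real N * real m powr - s"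
    unfolding dirichlet_term_def
  proof (rule abs_sum_antimono_le[OF abs_partial_sum_le])
    fix k assume "m \<le> k"
    thus "real (Suc k) powr - s \<le> real k powr - s"
      using assms by (intro powr_mono2') auto
  qed simp
  also have "real m powr - s \<le> real m powr - 1" using assms by (intro powr_mono) auto
  also have "\<dots> = 1 / real m" using assms by (simp add: powr_minus_divide)
  finally show ?thesis by (simp add: mult_left_mono)
qed

lemma null_sequence: "(\<lambda>m. 2 * real N / real m) \<longlonglongrightarrow> 0"
  by real_asymp

lemma summable_dirichlet_term:
  assumes "s \<ge> 1"
  shows "summable (dirichlet_term s)"
proof (rule summable_Cauchy'[OF _ null_sequence])
  show "\<forall>\<^sub>F m in sequentially. \<forall>n\<ge>m. norm (sum (dirichlet_term s) {m..<n}) \<le> 2 * real N / real m"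
    using eventually_gt_at_top[of "0::nat"] by eventually_elim (use abs_segment_le[OF assms] in auto)
qed

lemma abs_tail_le:
  assumes "s \<ge> 1" "m > 0"
  shows "\<bar>L s - (\<Sum>k<m. dirichlet_term s k)\<bar> \<le> 2 * real N / real m"
proof (rule LIMSEQ_le_const2)
  show "(\<lambda>n. \<bar>(\<Sum>k<n. dirichlet_term s k) - (\<Sum>k<m. dirichlet_term s k)\<bar>) \<longlonglongrightarrow> \<bar>L s - (\<Sum>k<m. dirichlet_term s k)\<bar>"
    unfolding L_def by (intro tendsto_intros summable_LIMSEQ summable_dirichlet_term assms)
  have "(\<Sum>k<n. dirichlet_term s k) - (\<Sum>k<m. dirichlet_term s k) = (\<Sum>k=m..<n. dirichlet_term s k)" if "n \<ge> m" for n
    using sum_diff_nat_ivl[of 0 m n "dirichlet_term s"] that by (simp add: lessThan_atLeast0)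
  thus "\<exists>K. \<forall>n\<ge>K. \<bar>(\<Sum>k<n. dirichlet_term s k) - (\<Sum>k<m. dirichlet_term s k)\<bar> \<le> 2 * real N / real m"
    using abs_segment_le[OF assms] by (intro exI[of _ m]) simp
qed

lemma L_tendsto_at_one: "(L \<longlongrightarrow> L 1) (at_right 1)"
proof -
  have continuous: "continuous_on {1..} (\<lambda>s. real k powr - s)" for k
    by (cases "k = 0") (auto intro!: continuous_intros)
  have "continuous_on {1..} L"
  proof (rule uniform_limit_theorem)
    show "\<forall>\<^sub>F m in sequentially. continuous_on {1..} (\<lambda>s. \<Sum>k<m. dirichlet_term s k)"
      unfolding dirichlet_term_def by (intro always_eventually allI continuous_intros continuous)
    show "uniform_limit {1..} (\<lambda>m s. \<Sum>k<m. dirichlet_term s k) L sequentially"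
    proof (rule uniform_limitI)
      fix e :: real assume "e > 0"
      hence "\<forall>\<^sub>F m in sequentially. 2 * real N / real m < e"
        using null_sequence by (auto dest: order_tendstoD(2))
      thus "\<forall>\<^sub>F m in sequentially. \<forall>s\<in>{1..}. dist (\<Sum>k<m. dirichlet_term s k) (L s) < e"
        using eventually_gt_at_top[of "0::nat"]
      proof eventually_elim
        case (elim m)
        thus ?case using abs_tail_le[of _ m]
          by (auto simp: dist_real_def abs_minus_commute intro: le_less_trans)
      qed
    qed
  qed simp
  hence "(L \<longlongrightarrow> L 1) (at 1 within {1..})" by (simp add: continuous_on_def)
  thus ?thesis by (rule tendsto_within_subset) auto
qed

end

section \<open>Divisor sums of a real character\<close>

context real_character
begin

text \<open>The Dirichlet convolution of \<open>\<psi>\<close> with 1; these are the coefficients of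
  the Lambert series of \<open>\<psi>\<close>.\<close>

definition divisor_sum :: "nat \<Rightarrow> real" where
  "divisor_sum n = (\<Sum>d | d dvd n. \<psi> d)"

lemma divisor_sum_mult_coprime:
  assumes "coprime m n" "m > 0" "n > 0"
  shows "divisor_sum (m * n) = divisor_sum m * divisor_sum n"
proof -
  have "inj_on (\<lambda>(x, y). x * y) ({d. d dvd m} \<times> {d. d dvd n})"
  proof (rule inj_onI, clarsimp)
    fix x y x' y' assume *: "x dvd m" "y dvd n" "x' dvd m" "y' dvd n" "x * y = x' * y'"
    have "coprime x y'" "coprime x' y" 
      using * assms(1) coprime_divisors by blast+
    hence "x dvd x'" "x' dvd x"
      using * by (metis coprime_dvd_mult_left_iff dvd_triv_left)+
    hence "x = x'" by (rule dvd_antisym)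
    moreover have "x \<noteq> 0" using * assms by auto
    ultimately show "x = x' \<and> y = y'" using * by simp
  qed
  moreover have "(\<lambda>(x, y). x * y) ` ({d. d dvd m} \<times> {d. d dvd n}) = {d. d dvd m * n}"
  proof (intro equalityI subsetI)
    fix d assume "d \<in> {d. d dvd m * n}"
    then obtain x y where "d = x * y" "x dvd m" "y dvd n" using division_decomp by blast
    thus "d \<in> (\<lambda>(x, y). x * y) ` ({d. d dvd m} \<times> {d. d dvd n})" by auto
  qed (auto intro: mult_dvd_mono)
  ultimately have "divisor_sum (m * n) = (\<Sum>(x, y)\<in>{d. d dvd m} \<times> {d. d dvd n}. \<psi> (x * y))"
    unfolding divisor_sum_def by (subst sum.reindex_cong[of "\<lambda>(x, y). x * y"]) auto
  thus ?thesis
    unfolding divisor_sum_def by (simp add: mult sum_product sum.cartesian_product)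
qed

lemma divisor_sum_prime_power:
  assumes "prime p"
  shows "divisor_sum (p ^ k) = (\<Sum>i\<le>k. \<psi> p ^ i)"
proof -
  have "\<psi> (p ^ i) = \<psi> p ^ i" for i using one by (induction i) (simp_all add: mult)
  moreover have "{d. d dvd p ^ k} = (\<lambda>i. p ^ i) ` {..k}"
    using divides_primepow_nat[OF assms] by auto
  moreover have "inj_on (\<lambda>i. p ^ i) {..k}"
    using prime_gt_1_nat[OF assms] by (auto intro: inj_onI)
  ultimately show ?thesis unfolding divisor_sum_def by (simp add: sum.reindex)
qed

text \<open>The sum of \<open>\<psi> p ^ i\<close> over \<open>i \<le> k\<close> is
  \<open>k + 1\<close> for \<open>\<psi> p = 1\<close>, is 1 for \<open>\<psi> p = 0\<close>, and
  alternates between 1 and 0 for \<open>\<psi> p = -1\<close>.\<close>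

lemma divisor_sum_prime_power_ge:
  assumes "prime p"
  shows "divisor_sum (p ^ k) \<ge> (if even k then 1 else 0)"
proof -
  have "(\<Sum>i\<le>k. (-1 :: real) ^ i) = (if even k then 1 else 0)" by (induction k) auto
  thus ?thesis unfolding divisor_sum_prime_power[OF assms] using range[of p]
    by (auto simp: power_0_left)
qed

text \<open>Multiplicativity, splitting off the full power of one prime; in a square this power has
  an even exponent.\<close>

lemma divisor_sum_nonneg: "n > 0 \<Longrightarrow> divisor_sum n \<ge> 0"
  and divisor_sum_square: "n > 0 \<Longrightarrow> divisor_sum (n\<^sup>2) \<ge> 1"
proof -
  have "n > 0 \<Longrightarrow> divisor_sum n \<ge> 0 \<and> divisor_sum (n\<^sup>2) \<ge> 1"
  proof (induction n rule: less_induct)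
    case (less n)
    show ?case
    proof (cases "n = 1")
      case True
      thus ?thesis using one by (simp add: divisor_sum_def)
    next
      case False
      then obtain p where p: "prime p" "p dvd n" using prime_factor_nat by blast
      define k where "k = multiplicity p n"
      obtain m where m: "n = p ^ k * m" "\<not> p dvd m"
        using multiplicity_decompose'[of n p] less.prems p unfolding k_def
        by (metis not_prime_unit gr_implies_not0)
      have "m > 0" using m less.prems by (cases m) auto
      have "k > 0" unfolding k_def using p less.prems by (simp add: prime_multiplicity_gt_zero_iff)
      hence "p ^ k > 1" using one_less_power[OF prime_gt_1_nat[OF p(1)]] by simp
      hence "m < n" using m \<open>m > 0\<close> by simp
      note IH = less.IH[OF this \<open>m > 0\<close>]
      have "coprime p m" using p m by (simp add: prime_imp_coprime)
      hence c: "coprime (p ^ k) m" "coprime (p ^ (2 * k)) (m\<^sup>2)" by auto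
      have "p > 0" using p prime_gt_0_nat by blast
      have "divisor_sum n = divisor_sum (p ^ k) * divisor_sum m"
        unfolding m(1) using c \<open>m > 0\<close> \<open>p > 0\<close> by (intro divisor_sum_mult_coprime) auto
      moreover have "n\<^sup>2 = p ^ (2 * k) * m\<^sup>2" unfolding m(1) by (simp add: power_mult_distrib power_mult mult.commute)
      hence "divisor_sum (n\<^sup>2) = divisor_sum (p ^ (2 * k)) * divisor_sum (m\<^sup>2)"
        using c \<open>m > 0\<close> \<open>p > 0\<close> by (simp add: divisor_sum_mult_coprime)
      moreover have "divisor_sum (p ^ k) \<ge> 0" "divisor_sum (p ^ (2 * k)) \<ge> 1"
        using divisor_sum_prime_power_ge[OF p(1), of k] divisor_sum_prime_power_ge[OF p(1), of "2 * k"]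
        by (auto split: if_splits)
      moreover have "1 * 1 \<le> divisor_sum (p ^ (2 * k)) * divisor_sum (m\<^sup>2)"
        using calculation IH by (intro mult_mono) auto
      ultimately show ?thesis using IH by simp
    qed
  qed
  thus "n > 0 \<Longrightarrow> divisor_sum n \<ge> 0" "n > 0 \<Longrightarrow> divisor_sum (n\<^sup>2) \<ge> 1" by auto
qed

end

section \<open>Estimates for Lambert series\<close>

lemma geometric_sum_ge:
  fixes y :: real
  shows "real (Suc m) * y ^ m \<le> (\<Sum>i\<le>m. (y\<^sup>2) ^ i)"
proof -
  \<comment> \<open>The terms of index \<open>i\<close> and \<open>m - i\<close> have product
    \<open>(y ^ m)\<^sup>2\<close>, so their sum is at least \<open>2 * y ^ m\<close>.\<close>
  have "(\<Sum>i\<le>m. 2 * y ^ m) \<le> (\<Sum>i\<le>m. (y\<^sup>2) ^ i + (y\<^sup>2) ^ (m - i))"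
  proof (rule sum_mono)
    fix i assume "i \<in> {..m}"
    hence "y ^ m = y ^ i * y ^ (m - i)" by (simp add: power_add[symmetric])
    moreover have "0 \<le> (y ^ i - y ^ (m - i))\<^sup>2" by simp
    ultimately show "2 * y ^ m \<le> (y\<^sup>2) ^ i + (y\<^sup>2) ^ (m - i)"
      by (simp add: power2_diff power_mult[symmetric] mult_ac)
  qed
  also have "(\<Sum>i\<le>m. (y\<^sup>2) ^ i + (y\<^sup>2) ^ (m - i)) = (\<Sum>i\<le>m. (y\<^sup>2) ^ i) + (\<Sum>i\<le>m. (y\<^sup>2) ^ (m - i))"
    by (rule sum.distrib)
  also have "(\<Sum>i\<le>m. (y\<^sup>2) ^ (m - i)) = (\<Sum>i\<le>m. (y\<^sup>2) ^ i)"
    by (rule sum.reindex_bij_witness[of _ "\<lambda>i. m - i" "\<lambda>i. m - i"]) auto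
  finally show ?thesis by simp
qed

text \<open>\<open>b n\<close> compares the term \<open>1 / n\<close> of the series at
  \<open>s = 1\<close>, scaled by \<open>1 / (1 - x)\<close>, with the Lambert term. Monotonicity
  reduces to \<open>x ^ n * n * (n + 1) \<le> S n * S (n + 1)\<close> for geometric sums
  \<open>S\<close>, which follows from \<open>geometric_sum_ge\<close>.\<close>

lemma lambert_difference_antimono:
  fixes x :: real
  assumes x: "0 < x" "x < 1" and "n > 0"
  defines "b \<equiv> \<lambda>n. 1 / (real n * (1 - x)) - x ^ n / (1 - x ^ n)"
  shows "b (Suc n) \<le> b n" and "b n \<ge> 0"
proof -
  \<comment> \<open>The square root avoids half-integral exponents of \<open>x\<close> in the bound
    for geometric sums.\<close>
  define y where "y = sqrt x"
  have y: "0 < y" "y \<le> 1" "y\<^sup>2 = x" using x unfolding y_def by auto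
  obtain m where m: "n = Suc m" using \<open>n > 0\<close> gr0_implies_Suc by blast
  define S where "S k = (\<Sum>i<k. x ^ i)" for k
  have S: "1 - x ^ k = (1 - x) * S k" for k unfolding S_def by (rule one_diff_power_eq)
  have S_Suc: "S (Suc n) = 1 + x * S n"
    unfolding S_def by (subst sum.lessThan_Suc_shift) (simp add: sum_distrib_left)
  have S_ge: "S n \<ge> real n * y ^ m" "S (Suc n) \<ge> real (Suc n) * y ^ n"
    using geometric_sum_ge[of m y] geometric_sum_ge[of n y] unfolding S_def m y(3)
    by (simp_all only: lessThan_Suc_atMost)
  have S_pos: "S n > 0" "S (Suc n) > 0"
    using S_ge y(1) \<open>n > 0\<close> by (auto intro: less_le_trans[rotated] mult_pos_pos simp del: of_nat_Suc)
  have b: "b k = (1 / real k - x ^ k / S k) / (1 - x)" for k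
    unfolding b_def S using x by (simp add: diff_divide_distrib mult.commute)
  have "x ^ n * (real n * real (Suc n)) \<le> y ^ m * y ^ n * (real n * real (Suc n))"
  proof (rule mult_right_mono)
    have "x ^ n = y ^ m * y ^ n * y"
      unfolding y(3)[symmetric] m by (simp add: power2_eq_square power_mult_distrib)
    also have "\<dots> \<le> y ^ m * y ^ n * 1" using y by (intro mult_left_mono) auto
    finally show "x ^ n \<le> y ^ m * y ^ n" by simp
  qed simp
  also have "\<dots> = (real n * y ^ m) * (real (Suc n) * y ^ n)" by (simp add: mult_ac)
  also have "\<dots> \<le> S n * S (Suc n)" using S_ge S_pos y by (intro mult_mono) auto
  finally have key: "x ^ n * (real n * real (Suc n)) \<le> S n * S (Suc n)" .
  have "x ^ n / S n - x ^ Suc n / S (Suc n) = x ^ n * (S (Suc n) - x * S n) / (S n * S (Suc n))"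
    using S_pos by (simp add: field_simps)
  also have "\<dots> = x ^ n / (S n * S (Suc n))" using S_Suc by simp
  also have "\<dots> \<le> 1 / (real n * real (Suc n))"
    using key S_pos \<open>n > 0\<close> by (simp add: divide_simps del: of_nat_Suc)
  also have "\<dots> = 1 / real n - 1 / real (Suc n)" using \<open>n > 0\<close> by (simp add: field_simps)
  finally show "b (Suc n) \<le> b n" unfolding b using x by (intro divide_right_mono) auto
  have "real n * x ^ n \<le> real n * y ^ m"
  proof (rule mult_left_mono)
    have "x ^ n = y ^ m * (y ^ m * y\<^sup>2)"
      unfolding y(3)[symmetric] m by (simp add: power2_eq_square power_mult_distrib)
    also have "\<dots> \<le> y ^ m * 1" using y by (intro mult_left_mono mult_le_one power_le_one) auto
    finally show "x ^ n \<le> y ^ m" by simp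
  qed simp
  hence "real n * x ^ n \<le> S n" using S_ge by linarith
  hence "x ^ n / S n \<le> 1 / real n" using S_pos \<open>n > 0\<close> by (simp add: divide_simps mult.commute)
  thus "b n \<ge> 0" unfolding b using x by simp
qed

context real_character
begin

text \<open>Both sides run over the pairs \<open>(n, j)\<close> with \<open>n * j \<le> M\<close>;
  on the right they are grouped by the product \<open>m = n * j\<close>.\<close>

lemma lambert_sum:
  "(\<Sum>n=1..M. \<psi> n * (\<Sum>j=1..M div n. x ^ (n * j))) = (\<Sum>m=1..M. divisor_sum m * x ^ m)"
proof -
  have "(\<Sum>n=1..M. \<psi> n * (\<Sum>j=1..M div n. x ^ (n * j))) =
        (\<Sum>(n, j)\<in>(SIGMA n:{1..M}. {1..M div n}). \<psi> n * x ^ (n * j))"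
    by (simp add: sum.Sigma sum_distrib_left)
  also have "\<dots> = (\<Sum>(m, d)\<in>(SIGMA m:{1..M}. {d. d dvd m}). \<psi> d * x ^ m)"
    by (rule sum.reindex_bij_witness[of _ "\<lambda>(m, d). (d, m div d)" "\<lambda>(n, j). (n * j, n)"])
      (auto simp: div_le_mono dvd_imp_le less_eq_div_iff_mult_less_eq mult.commute div_greater_zero_iff
         Suc_le_eq intro: dvd_pos_nat order_trans[OF dvd_imp_le])
  also have "\<dots> = (\<Sum>m=1..M. divisor_sum m * x ^ m)"
    by (subst sum.Sigma[symmetric]) (auto simp: divisor_sum_def sum_distrib_right)
  finally show ?thesis .
qed

text \<open>Only the square indices are kept, where the coefficients are at least 1. Completing each
  of the \<open>M\<close> truncated geometric series costs at most
  \<open>x ^ M / (1 - x)\<close>.\<close>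

lemma lambert_lower_bound:
  fixes x :: real
  assumes x: "0 < x" "x < 1" and KM: "K\<^sup>2 \<le> M"
  shows "(\<Sum>k=1..K. x ^ k\<^sup>2) \<le> (\<Sum>n=1..M. \<psi> n * (x ^ n / (1 - x ^ n))) + real M * (x ^ M / (1 - x))"
proof -
  have "(\<Sum>k=1..K. x ^ k\<^sup>2) \<le> (\<Sum>k=1..K. divisor_sum (k\<^sup>2) * x ^ k\<^sup>2)"
  proof (rule sum_mono)
    fix k assume "k \<in> {1..K}"
    thus "x ^ k\<^sup>2 \<le> divisor_sum (k\<^sup>2) * x ^ k\<^sup>2"
      using mult_right_mono[OF divisor_sum_square[of k], of "x ^ k\<^sup>2"] x by simp
  qed
  also have "\<dots> = (\<Sum>m\<in>(\<lambda>k. k\<^sup>2) ` {1..K}. divisor_sum m * x ^ m)"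
    by (subst sum.reindex) (auto simp: inj_on_def)
  also have "\<dots> \<le> (\<Sum>m=1..M. divisor_sum m * x ^ m)"
  proof (rule sum_mono2)
    show "(\<lambda>k. k\<^sup>2) ` {1..K} \<subseteq> {1..M}"
    proof (clarsimp simp: Suc_le_eq)
      fix k assume "0 < k" "k \<le> K"
      thus "k\<^sup>2 \<le> M" using power_mono[of k K 2] KM by linarith
    qed
  qed (use x in \<open>auto intro!: mult_nonneg_nonneg divisor_sum_nonneg\<close>)
  also have "\<dots> = (\<Sum>n=1..M. \<psi> n * (\<Sum>j=1..M div n. x ^ (n * j)))"
    by (rule lambert_sum[symmetric])
  also have "\<dots> \<le> (\<Sum>n=1..M. \<psi> n * (x ^ n / (1 - x ^ n)) + x ^ M / (1 - x))"
  proof (rule sum_mono)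
    fix n assume "n \<in> {1..M}"
    hence n: "n > 0" by simp
    define q where "q = M div n"
    have xn: "0 < x ^ n" "x ^ n \<le> x" 
      using x n power_decreasing[of 1 n x] by auto
    have "(1 - x ^ n) * (\<Sum>j=1..r. x ^ (n * j)) = x ^ n - x ^ (n * Suc r)" for r
    proof (induction r)
      case (Suc r)
      have "(1 - x ^ n) * (\<Sum>j=1..Suc r. x ^ (n * j)) =
            (1 - x ^ n) * (\<Sum>j=1..r. x ^ (n * j)) + (1 - x ^ n) * x ^ (n * Suc r)"
        by (simp add: distrib_left)
      also have "\<dots> = x ^ n - x ^ n * x ^ (n * Suc r)"
        unfolding Suc.IH by (simp only: left_diff_distrib mult_1_left diff_add_cancel add_diff_eq)
      finally show ?case by (simp only: power_add[symmetric] mult_Suc_right[of n "Suc r"])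
    qed simp
    hence "(\<Sum>j=1..q. x ^ (n * j)) = (x ^ n - x ^ (n * Suc q)) / (1 - x ^ n)"
      using xn x by (simp add: eq_divide_eq mult.commute)
    hence geo: "x ^ n / (1 - x ^ n) - (\<Sum>j=1..q. x ^ (n * j)) = x ^ (n * Suc q) / (1 - x ^ n)"
      by (simp add: diff_divide_distrib)
    \<comment> \<open>\<open>n * Suc q\<close> is the first exponent omitted from the truncated
      series.\<close>
    have "M < n * Suc q" unfolding q_def using n by (metis dividend_less_times_div mult_Suc_right)
    hence "x ^ (n * Suc q) \<le> x ^ M" using x by (intro power_decreasing) auto
    hence "x ^ (n * Suc q) / (1 - x ^ n) \<le> x ^ M / (1 - x)" using x xn by (intro frac_le) auto
    moreover have "x ^ (n * Suc q) / (1 - x ^ n) \<ge> 0" using x xn by simp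
    ultimately have "\<bar>x ^ n / (1 - x ^ n) - (\<Sum>j=1..q. x ^ (n * j))\<bar> \<le> x ^ M / (1 - x)"
      unfolding geo by linarith
    hence "\<bar>\<psi> n\<bar> * \<bar>x ^ n / (1 - x ^ n) - (\<Sum>j=1..q. x ^ (n * j))\<bar> \<le> 1 * (x ^ M / (1 - x))"
      by (intro mult_mono abs_le_one) auto
    thus "\<psi> n * (\<Sum>j=1..M div n. x ^ (n * j)) \<le> \<psi> n * (x ^ n / (1 - x ^ n)) + x ^ M / (1 - x)"
      unfolding q_def[symmetric] abs_mult[symmetric] right_diff_distrib by linarith
  qed
  also have "\<dots> = (\<Sum>n=1..M. \<psi> n * (x ^ n / (1 - x ^ n))) + real M * (x ^ M / (1 - x))"
    by (simp add: sum.distrib)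
  finally show ?thesis .
qed

end

section \<open>Nonvanishing of L at 1\<close>

context nonprincipal_character
begin

text \<open>If \<open>L 1 = 0\<close>, the partial sums of \<open>L 1\<close> are tails and tend to
  0, so up to vanishing errors the Lambert series is minus the sum of \<open>\<psi> n * b n\<close>.
  Summation by parts bounds this by \<open>2 * N * b 1\<close>.\<close>

lemma square_powers_le_if_L_one_zero:
  fixes x :: real
  assumes L: "L 1 = 0" and x: "0 < x" "x < 1"
  shows "(\<Sum>k=1..K. x ^ k\<^sup>2) \<le> 2 * real N"
proof (rule LIMSEQ_le_const)
  define b where "b n = 1 / (real n * (1 - x)) - x ^ n / (1 - x ^ n)" for n
  have b: "b (Suc n) \<le> b n" "b n \<ge> 0" if "n \<ge> 1" for n
    using lambert_difference_antimono[OF x, of n] that unfolding b_def by auto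
  \<comment> \<open>This value makes the final bound independent of \<open>x\<close>.\<close>
  have "b 1 = 1" unfolding b_def using x by (simp add: field_simps)
  show "(\<lambda>M. 1 / (1 - x) * (2 * real N / real (Suc M)) + 2 * real N * 1 + real M * x ^ M / (1 - x))
        \<longlonglongrightarrow> 2 * real N"
  proof -
    have "(\<lambda>M. 2 * real N / real (Suc M)) \<longlonglongrightarrow> 0" by real_asymp
    moreover have "(\<lambda>M. real M * x ^ M) \<longlonglongrightarrow> 0"
      using powser_times_n_limit_0[of x] x by simp
    ultimately have "(\<lambda>M. 1 / (1 - x) * (2 * real N / real (Suc M)) + 2 * real N * 1 + real M * x ^ M / (1 - x))
        \<longlonglongrightarrow> 1 / (1 - x) * 0 + 2 * real N * 1 + 0 / (1 - x)"
      using x by (intro tendsto_intros) auto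
    thus ?thesis by simp
  qed
  show "\<exists>M0. \<forall>M\<ge>M0. (\<Sum>k=1..K. x ^ k\<^sup>2) \<le>
          1 / (1 - x) * (2 * real N / real (Suc M)) + 2 * real N * 1 + real M * x ^ M / (1 - x)"
  proof (intro exI allI impI)
    fix M assume M: "K\<^sup>2 \<le> M"
    have "(\<Sum>n=1..M. \<psi> n * (x ^ n / (1 - x ^ n))) =
          (\<Sum>n=1..M. 1 / (1 - x) * dirichlet_term 1 n) - (\<Sum>n=1..M. \<psi> n * b n)"
      unfolding sum_subtractf[symmetric]
      by (intro sum.cong) (auto simp: b_def dirichlet_term_def powr_minus_divide algebra_simps)
    also have "(\<Sum>n=1..M. 1 / (1 - x) * dirichlet_term 1 n) = 1 / (1 - x) * (\<Sum>n<Suc M. dirichlet_term 1 n)"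
      by (subst sum.lessThan_Suc_shift)
        (simp add: sum_distrib_left sum.atLeast1_atMost_eq)
    also have "\<dots> \<le> 1 / (1 - x) * (2 * real N / real (Suc M))"
      using abs_tail_le[of 1 "Suc M"] L x by (intro mult_left_mono) (auto simp: abs_le_iff)
    finally have "(\<Sum>n=1..M. \<psi> n * (x ^ n / (1 - x ^ n))) \<le>
        1 / (1 - x) * (2 * real N / real (Suc M)) - (\<Sum>n=1..M. \<psi> n * b n)" by simp
    moreover have "\<bar>\<Sum>n=1..<Suc M. \<psi> n * b n\<bar> \<le> 2 * real N * b 1"
      by (rule abs_sum_antimono_le[OF abs_partial_sum_le]) (use b in auto)
    hence "- (\<Sum>n=1..M. \<psi> n * b n) \<le> 2 * real N * 1"
      unfolding \<open>b 1 = 1\<close> by (simp add: atLeastLessThanSuc_atLeastAtMost abs_le_iff)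
    ultimately show "(\<Sum>k=1..K. x ^ k\<^sup>2) \<le>
        1 / (1 - x) * (2 * real N / real (Suc M)) + 2 * real N * 1 + real M * x ^ M / (1 - x)"
      using lambert_lower_bound[OF x M] by simp
  qed
qed

text \<open>Monsky's argument: if \<open>L 1\<close> were 0, the Lambert series of \<open>\<psi>\<close> would stay bounded as \<open>x \<rightarrow> 1\<close>,
  although its coefficients are nonnegative and at least 1 at the squares.\<close>

lemma L_one_nonzero: "L 1 \<noteq> 0"
proof
  assume L: "L 1 = 0"
  \<comment> \<open>At \<open>x = 1\<close> the sum consists of \<open>K\<close> ones, just more
    than the bound \<open>2 * N\<close>.\<close>
  define K where "K = 2 * N + 1"
  have "((\<lambda>x::real. \<Sum>k=1..K. x ^ k\<^sup>2) \<longlongrightarrow> (\<Sum>k=1..K. 1 ^ k\<^sup>2)) (at_left 1)"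
    by (intro tendsto_intros)
  moreover have "\<forall>\<^sub>F x::real in at_left 1. (\<Sum>k=1..K. x ^ k\<^sup>2) \<le> 2 * real N"
  proof (rule eventually_mono[OF eventually_at_left_real[of 0 1]])
    show "(\<Sum>k=1..K. x ^ k\<^sup>2) \<le> 2 * real N" if "x \<in> {0<..<1}" for x :: real
      using square_powers_le_if_L_one_zero[OF L, of x K] that by simp
  qed simp
  ultimately have "(\<Sum>k=1..K. (1::real) ^ k\<^sup>2) \<le> 2 * real N"
    by (intro tendsto_upperbound[of _ _ "at_left 1"]) auto
  thus False unfolding K_def by simp
qed

lemma prime_sum_bounded: "\<exists>B. \<forall>\<^sub>F s in at_right 1. \<bar>prime_sum s\<bar> \<le> B"
proof -
  have gt: "\<forall>\<^sub>F s::real in at_right 1. s > 1" by (simp add: eventually_at_right_less)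
  hence "\<forall>\<^sub>F s in at_right 1. L s \<ge> 0"
    by eventually_elim (use log_euler_product(1) in force)
  hence "L 1 \<ge> 0" by (intro tendsto_lowerbound[OF L_tendsto_at_one]) auto
  hence "L 1 > 0" using L_one_nonzero by simp
  hence "((\<lambda>s. \<bar>ln (L s)\<bar>) \<longlongrightarrow> \<bar>ln (L 1)\<bar>) (at_right 1)"
    using L_tendsto_at_one by (intro tendsto_intros) auto
  hence "\<forall>\<^sub>F s in at_right 1. \<bar>ln (L s)\<bar> < \<bar>ln (L 1)\<bar> + 1"
    by (rule order_tendstoD(2)) simp
  hence "\<forall>\<^sub>F s in at_right 1. \<bar>prime_sum s\<bar> \<le> \<bar>ln (L 1)\<bar> + 1 + 2 * (\<Sum>n. 1 / real n ^ 2)"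
    using gt
  proof eventually_elim
    case (elim s)
    thus ?case using log_euler_product(2)[of s] by linarith
  qed
  thus ?thesis ..
qed

end

section \<open>Divergence of the prime sum of the principal character\<close>

interpretation principal: real_character "\<lambda>_. 1"
  by (rule real_character_one)

text \<open>A partial sum of the harmonic series beyond \<open>Z\<close> is the limit of the
  corresponding partial sums for \<open>s > 1\<close>, which are lower bounds for
  \<open>L s\<close>.\<close>

lemma principal_L_at_top: "filterlim principal.L at_top (at_right 1)"
  unfolding filterlim_at_top
proof
  fix Z :: real
  have "\<not> summable (\<lambda>n. real n powr - 1)" by (subst summable_real_powr_iff) simp
  hence "\<exists>M. (\<Sum>n<M. real n powr - 1) > Z"
    using summableI_nonneg_bounded[of "\<lambda>n. real n powr - 1" Z] by (force simp: not_le)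
  then obtain M where M: "(\<Sum>n<M. real n powr - 1) > Z" ..
  have powr: "((\<lambda>s. real n powr - s) \<longlongrightarrow> real n powr - 1) (at_right 1)" for n
  proof (cases "n = 0")
    case False
    thus ?thesis by (intro tendsto_intros) auto
  qed simp
  have "((\<lambda>s. \<Sum>n<M. real n powr - s) \<longlongrightarrow> (\<Sum>n<M. real n powr - 1)) (at_right 1)"
    by (intro tendsto_sum powr)
  hence "\<forall>\<^sub>F s in at_right 1. (\<Sum>n<M. real n powr - s) > Z"
    using M by (rule order_tendstoD(1))
  moreover have "\<forall>\<^sub>F s::real in at_right 1. s > 1" by (simp add: eventually_at_right_less)
  ultimately show "\<forall>\<^sub>F s in at_right 1. Z \<le> principal.L s"
  proof eventually_elim
    case (elim s)
    have "summable (principal.dirichlet_term s)"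
      using principal.summable_abs_dirichlet_term elim summable_rabs_cancel by blast
    hence "(\<Sum>n<M. principal.dirichlet_term s n) \<le> principal.L s"
      unfolding principal.L_def
      by (rule sum_le_suminf) (simp_all add: principal.dirichlet_term_def[of s "_ :: nat"])
    thus ?case using elim by (simp add: principal.dirichlet_term_def)
  qed
qed

lemma principal_prime_sum_at_top: "filterlim principal.prime_sum at_top (at_right 1)"
proof (rule filterlim_at_top_mono)
  show "filterlim (\<lambda>s. - (2 * (\<Sum>n. 1 / real n ^ 2)) + ln (principal.L s)) at_top (at_right 1)"
    by (intro filterlim_tendsto_add_at_top[OF tendsto_const]
        filterlim_compose[OF ln_at_top principal_L_at_top])
  have "\<forall>\<^sub>F s::real in at_right 1. s > 1" by (simp add: eventually_at_right_less)
  thus "\<forall>\<^sub>F s in at_right 1. - (2 * (\<Sum>n. 1 / real n ^ 2)) + ln (principal.L s) \<le> principal.prime_sum s"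
  proof eventually_elim
    case (elim s)
    thus ?case using principal.log_euler_product(2)[of s] by linarith
  qed
qed

lemma real_character_prod:
  assumes "\<And>i. i \<in> S \<Longrightarrow> real_character (f i)"
  shows "real_character (\<lambda>n. \<Prod>i\<in>S. f i n)"
proof
  show "(\<Prod>i\<in>S. f i 1) = 1" using assms by (intro prod.neutral) (auto simp: real_character_def)
  show "(\<Prod>i\<in>S. f i (m * n)) = (\<Prod>i\<in>S. f i m) * (\<Prod>i\<in>S. f i n)" for m n
    using assms by (simp add: real_character_def prod.distrib)
  show "(\<Prod>i\<in>S. f i n) \<in> {-1, 0, 1}" for n
  proof (cases "finite S")
    case True
    thus ?thesis using assms
    proof (induction S)
      case (insert i S)
      hence "f i n \<in> {-1, 0, 1}" "(\<Prod>i\<in>S. f i n) \<in> {-1, 0, 1}"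
        using real_character.range by auto
      thus ?case using insert.hyps by auto
    qed simp
  qed simp
qed

section \<open>Primes with prescribed character values\<close>

text \<open>By Euler's theorem some positive power of \<open>n\<close> is congruent to 1 modulo
  \<open>N\<close>.\<close>

lemma (in real_character) nonzero_if_coprime_period:
  assumes "\<And>n. \<psi> (n + N) = \<psi> n" "coprime n N" "N > 0"
  shows "\<psi> n \<noteq> 0"
proof
  assume "\<psi> n = 0"
  moreover have "totient N > 0" using assms(3) by simp
  then obtain t where "totient N = Suc t" using gr0_implies_Suc by blast
  ultimately have "\<psi> (n ^ totient N) = 0" by (simp add: mult)
  moreover have "n ^ totient N mod N = 1 mod N"
    using euler_theorem[OF assms(2)] by (simp add: cong_def)
  hence "\<psi> (n ^ totient N) = \<psi> 1"
    using periodic_mod[of \<psi> N, OF assms(1)] by metis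
  ultimately show False using one by simp
qed

text \<open>The product \<open>g\<close> of the factors \<open>1 + \<epsilon> i * f i\<close> is
  \<open>2 ^ card I\<close> at the desired primes and 0 at all others prime to \<open>N\<close>.
  Expanded over subsets of \<open>I\<close>, its prime sum consists of the divergent principal sum,
  from the empty set, and of sums that \<open>indep\<close> makes nonprincipal and hence bounded.
  Finitely many desired primes would bound the total.\<close>

theorem infinite_primes_prescribed_characters:
  fixes f :: "'i \<Rightarrow> nat \<Rightarrow> real" and \<epsilon> :: "'i \<Rightarrow> real"
  assumes I: "finite I" and N: "N > 0"
    and char: "\<And>i. i \<in> I \<Longrightarrow> real_character (f i)"
    and period: "\<And>i n. i \<in> I \<Longrightarrow> f i (n + N) = f i n"
    and indep: "\<And>S. S \<subseteq> I \<Longrightarrow> S \<noteq> {} \<Longrightarrow> \<exists>a. coprime a N \<and> (\<Prod>i\<in>S. f i a) = -1"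
    and \<epsilon>: "\<And>i. i \<in> I \<Longrightarrow> \<epsilon> i \<in> {-1, 1}"
  shows "infinite {p. prime p \<and> (\<forall>i\<in>I. f i p = \<epsilon> i)}"
proof
  define Z where "Z = {p. prime p \<and> (\<forall>i\<in>I. f i p = \<epsilon> i)}"
  assume "finite {p. prime p \<and> (\<forall>i\<in>I. f i p = \<epsilon> i)}"
  hence "finite Z" unfolding Z_def .
  \<comment> \<open>Divisors of \<open>N\<close> are exceptional too: there a character may be 0, so
    \<open>g\<close> need not vanish.\<close>
  define W where "W = Z \<union> {p. p dvd N}"
  have "finite W" unfolding W_def using \<open>finite Z\<close> N by simp
  define g where "g n = (\<Prod>i\<in>I. 1 + \<epsilon> i * f i n)" for n
  define F where "F S n = (\<Prod>i\<in>S. f i n)" for S n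
  define PS where "PS S = real_character.prime_sum (F S)" for S
  have char_F: "real_character (F S)" if "S \<subseteq> I" for S
    unfolding F_def using that by (intro real_character_prod char) auto
  have factor: "0 \<le> 1 + \<epsilon> i * f i n" "1 + \<epsilon> i * f i n \<le> 2" if "i \<in> I" for i n
    using real_character.range[OF char[OF that], of n] \<epsilon>[OF that] by auto
  have g_le: "g n \<le> 2 ^ card I" for n
    unfolding g_def using prod_mono[of I "\<lambda>i. 1 + \<epsilon> i * f i n" "\<lambda>_. 2"] factor by simp
  have g_zero: "g p = 0" if "prime p" "p \<notin> W" for p
  proof -
    from that obtain i where i: "i \<in> I" "f i p \<noteq> \<epsilon> i" unfolding W_def Z_def by auto
    have "coprime p N" using that unfolding W_def by (auto intro: prime_imp_coprime)
    hence "f i p \<noteq> 0"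
      using real_character.nonzero_if_coprime_period[OF char[OF i(1)] period[OF i(1)]] N by blast
    hence "1 + \<epsilon> i * f i p = 0"
      using real_character.range[OF char[OF i(1)], of p] \<epsilon>[OF i(1)] i(2) by auto
    thus ?thesis unfolding g_def using I i(1) by (intro prod_zero) auto
  qed
  have g_expand: "g n = (\<Sum>S\<in>Pow I. (\<Prod>i\<in>S. \<epsilon> i) * F S n)" for n
  proof -
    have "g n = (\<Prod>i\<in>I. \<epsilon> i * f i n + 1)" unfolding g_def by (simp add: add.commute)
    also have "\<dots> = (\<Sum>S\<in>Pow I. (\<Prod>i\<in>S. \<epsilon> i * f i n) * (\<Prod>i\<in>I - S. 1))"
      by (rule prod_add[OF I])
    finally show ?thesis unfolding F_def by (simp add: prod.distrib)
  qed
  have upper: "(\<Sum>S\<in>Pow I. (\<Prod>i\<in>S. \<epsilon> i) * PS S s) \<le> 2 ^ card I * card W" if s: "s > 1" for s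
  proof -
    have summ: "summable (\<lambda>n. if prime n then F S n * real n powr - s else 0)" if "S \<subseteq> I" for S
      using real_character.summable_prime_terms[OF char_F[OF that] s]
      unfolding real_character.dirichlet_term_def[OF char_F[OF that]] .
    have "(\<Sum>S\<in>Pow I. (\<Prod>i\<in>S. \<epsilon> i) * PS S s) =
        (\<Sum>S\<in>Pow I. \<Sum>n. (\<Prod>i\<in>S. \<epsilon> i) * (if prime n then F S n * real n powr - s else 0))"
    proof (rule sum.cong[OF refl])
      fix S assume "S \<in> Pow I"
      hence S: "S \<subseteq> I" by simp
      show "(\<Prod>i\<in>S. \<epsilon> i) * PS S s =
          (\<Sum>n. (\<Prod>i\<in>S. \<epsilon> i) * (if prime n then F S n * real n powr - s else 0))"
        unfolding PS_def real_character.prime_sum_def[OF char_F[OF S]]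
          real_character.dirichlet_term_def[OF char_F[OF S]]
        by (rule suminf_mult[OF summ[OF S], symmetric])
    qed
    also have "\<dots> = (\<Sum>n. \<Sum>S\<in>Pow I. (\<Prod>i\<in>S. \<epsilon> i) * (if prime n then F S n * real n powr - s else 0))"
      by (rule suminf_sum[symmetric]) (intro summable_mult summ, simp)
    also have "\<dots> = (\<Sum>n. if prime n then g n * real n powr - s else 0)"
      by (intro suminf_cong) (simp add: g_expand sum_distrib_right mult.assoc)
    also have "\<dots> = (\<Sum>n\<in>W. if prime n then g n * real n powr - s else 0)"
      by (intro suminf_finite \<open>finite W\<close>) (simp add: g_zero)
    also have "\<dots> \<le> (\<Sum>n\<in>W. 2 ^ card I)"
    proof (rule sum_mono)
      fix n
      show "(if prime n then g n * real n powr - s else 0) \<le> 2 ^ card I"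
      proof (cases "prime n")
        case True
        hence "real n \<ge> 1" using prime_ge_1_nat by simp
        hence "real n powr - s \<le> 1" using s powr_mono[of "- s" 0 "real n"] by simp
        hence "g n * real n powr - s \<le> 2 ^ card I * 1" using g_le by (intro mult_mono) auto
        thus ?thesis using True by simp
      qed simp
    qed
    finally show ?thesis by (simp add: mult.commute)
  qed
  have "\<exists>B. \<forall>\<^sub>F s in at_right 1. \<bar>PS S s\<bar> \<le> B" if S: "S \<subseteq> I" "S \<noteq> {}" for S
  proof -
    obtain a where a: "coprime a N" "F S a = -1" using indep[OF S] unfolding F_def by blast
    interpret F: nonprincipal_character "F S" N a
    proof (intro nonprincipal_character.intro char_F[OF S(1)] nonprincipal_character_axioms.intro a)
      show "F S (n + N) = F S n" for n unfolding F_def using S period by (intro prod.cong) auto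
    qed
    show ?thesis unfolding PS_def by (rule F.prime_sum_bounded)
  qed
  then obtain B where B: "\<forall>\<^sub>F s in at_right 1. \<bar>PS S s\<bar> \<le> B S" if "S \<subseteq> I" "S \<noteq> {}" for S
    by metis
  have "PS {} = principal.prime_sum" unfolding PS_def F_def by simp
  hence "filterlim (PS {}) at_top (at_right 1)" using principal_prime_sum_at_top by simp
  hence "\<forall>\<^sub>F s in at_right 1. PS {} s \<ge> 2 ^ card I * card W + (\<Sum>S\<in>Pow I - {{}}. B S) + 1"
    by (simp add: filterlim_at_top)
  moreover have "\<forall>\<^sub>F s in at_right 1. \<forall>S\<in>Pow I - {{}}. \<bar>PS S s\<bar> \<le> B S"
    using I B by (intro eventually_ball_finite) auto
  moreover have "\<forall>\<^sub>F s::real in at_right 1. s > 1" by (simp add: eventually_at_right_less)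
  ultimately have "\<forall>\<^sub>F s::real in at_right 1. False"
  proof eventually_elim
    case (elim s)
    have "\<bar>\<Prod>i\<in>S. \<epsilon> i\<bar> = 1" if "S \<subseteq> I" for S
      unfolding abs_prod using \<epsilon> that by (intro prod.neutral) fastforce
    hence "\<bar>(\<Prod>i\<in>S. \<epsilon> i) * PS S s\<bar> \<le> B S" if "S \<in> Pow I - {{}}" for S
      using elim(2) that by (simp add: abs_mult)
    hence "(\<Sum>S\<in>Pow I - {{}}. - B S) \<le> (\<Sum>S\<in>Pow I - {{}}. (\<Prod>i\<in>S. \<epsilon> i) * PS S s)"
      by (intro sum_mono) (simp add: abs_le_iff minus_le_iff)
    moreover have "(\<Sum>S\<in>Pow I. (\<Prod>i\<in>S. \<epsilon> i) * PS S s) =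
        PS {} s + (\<Sum>S\<in>Pow I - {{}}. (\<Prod>i\<in>S. \<epsilon> i) * PS S s)"
      using I by (subst sum.remove[of _ "{}"]) auto
    ultimately show False using upper[OF elim(3)] elim(1) by (simp add: sum_negf)
  qed
  thus False by simp
qed

section \<open>Ternary forms of determinant 1\<close>

text \<open>The symmetric matrix with diagonal \<open>a\<close>, \<open>b\<close>, \<open>c\<close> and entries \<open>d\<close>, \<open>e\<close>, \<open>f\<close> in the positions
  (2, 3), (1, 3), (1, 2) is the Gram matrix of three integer vectors \<open>u\<close>, \<open>v\<close>, \<open>w\<close>.\<close>

definition integer_gram :: "int \<Rightarrow> int \<Rightarrow> int \<Rightarrow> int \<Rightarrow> int \<Rightarrow> int \<Rightarrow> bool" where
  "integer_gram a b c d e f \<longleftrightarrow>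
     (\<exists>u1 u2 u3 v1 v2 v3 w1 w2 w3.
        u1 * u1 + u2 * u2 + u3 * u3 = a \<and> v1 * v1 + v2 * v2 + v3 * v3 = b \<and>
        w1 * w1 + w2 * w2 + w3 * w3 = c \<and> v1 * w1 + v2 * w2 + v3 * w3 = d \<and>
        u1 * w1 + u2 * w2 + u3 * w3 = e \<and> u1 * v1 + u2 * v2 + u3 * v3 = f)"

lemma integer_gramI:
  assumes "u1 * u1 + u2 * u2 + u3 * u3 = a" "v1 * v1 + v2 * v2 + v3 * v3 = b"
    "w1 * w1 + w2 * w2 + w3 * w3 = c" "v1 * w1 + v2 * w2 + v3 * w3 = d"
    "u1 * w1 + u2 * w2 + u3 * w3 = e" "u1 * v1 + u2 * v2 + u3 * v3 = f"
  shows "integer_gram a b c d e f"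
  unfolding integer_gram_def by (intro exI conjI) (rule assms)+

lemma integer_gram_swap_first: "integer_gram b a c e d f \<Longrightarrow> integer_gram a b c d e f"
  unfolding integer_gram_def
  by (elim exE conjE, intro exI conjI) (assumption | simp add: mult.commute)+

lemma integer_gram_swap_last: "integer_gram a c b d f e \<Longrightarrow> integer_gram a b c d e f"
  unfolding integer_gram_def
  by (elim exE conjE, intro exI conjI) (assumption | simp add: mult.commute)+

text \<open>The assumption concerns the Gram matrix after replacing \<open>v\<close> by
  \<open>v + k * u\<close>; subtracting \<open>k * u\<close> again gives the original one.\<close>

lemma integer_gram_shear_second:
  assumes "integer_gram a (b + 2 * k * f + k\<^sup>2 * a) c (d + k * e) e (f + k * a)"
  shows "integer_gram a b c d e f"
proof -
  from assms obtain u1 u2 u3 v1 v2 v3 w1 w2 w3 where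
    a: "u1 * u1 + u2 * u2 + u3 * u3 = a" and
    b: "v1 * v1 + v2 * v2 + v3 * v3 = b + 2 * k * f + k\<^sup>2 * a" and
    c: "w1 * w1 + w2 * w2 + w3 * w3 = c" and d: "v1 * w1 + v2 * w2 + v3 * w3 = d + k * e" and
    e: "u1 * w1 + u2 * w2 + u3 * w3 = e" and f: "u1 * v1 + u2 * v2 + u3 * v3 = f + k * a"
    unfolding integer_gram_def by blast
  have f': "f = u1 * v1 + u2 * v2 + u3 * v3 - k * (u1 * u1 + u2 * u2 + u3 * u3)"
    using a f by simp
  have b': "b = v1 * v1 + v2 * v2 + v3 * v3 - 2 * k * f - k\<^sup>2 * (u1 * u1 + u2 * u2 + u3 * u3)"
    using a b by simp
  have d': "d = v1 * w1 + v2 * w2 + v3 * w3 - k * (u1 * w1 + u2 * w2 + u3 * w3)"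
    using d e by simp
  show ?thesis
  proof (rule integer_gramI)
    show "(v1 - k * u1) * (v1 - k * u1) + (v2 - k * u2) * (v2 - k * u2) + (v3 - k * u3) * (v3 - k * u3) = b"
      unfolding b' f' by (simp add: power2_eq_square algebra_simps)
    show "(v1 - k * u1) * w1 + (v2 - k * u2) * w2 + (v3 - k * u3) * w3 = d"
      unfolding d' by (simp add: algebra_simps)
    show "u1 * (v1 - k * u1) + u2 * (v2 - k * u2) + u3 * (v3 - k * u3) = f"
      unfolding f' by (simp add: algebra_simps)
  qed (fact a c e)+
qed

lemma integer_gram_shear_third:
  assumes "integer_gram a b (c + 2 * k * e + k\<^sup>2 * a) (d + k * f) (e + k * a) f"
  shows "integer_gram a b c d e f"
  using assms integer_gram_shear_second integer_gram_swap_last by blast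

lemma integer_gram_shear_third_second:
  assumes "integer_gram a b (c + 2 * k * d + k\<^sup>2 * b) (d + k * b) (e + k * f) f"
  shows "integer_gram a b c d e f"
proof -
  have "integer_gram b a (c + 2 * k * d + k\<^sup>2 * b) (e + k * f) (d + k * b) f"
    using assms integer_gram_swap_first by blast
  thus ?thesis
    using integer_gram_shear_third integer_gram_swap_first by blast
qed

lemma exists_nearest_multiple:
  fixes x m :: int
  assumes "m > 0"
  shows "\<exists>k. 2 * \<bar>x + k * m\<bar> \<le> m"
proof -
  define k where "k = - ((2 * x + m) div (2 * m))"
  have "(2 * x + m) mod (2 * m) = 2 * x + m + k * (2 * m)"
    unfolding k_def by (simp add: minus_div_mult_eq_mod[symmetric] algebra_simps)
  moreover have "0 \<le> (2 * x + m) mod (2 * m)" "(2 * x + m) mod (2 * m) < 2 * m"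
    using assms by auto
  ultimately have "2 * \<bar>x + k * m\<bar> \<le> m" by (simp add: algebra_simps abs_if)
  thus ?thesis ..
qed

text \<open>Gauss reduction: as long as the matrix is not the identity, a shear followed by a swap of two
  basis vectors decreases either \<open>a\<close> or, keeping \<open>a\<close>, the leading 2 by 2 minor.\<close>

theorem integer_gram_if_det_one:
  assumes "a > 0" "a * b - f\<^sup>2 > 0"
    "a * b * c + 2 * d * e * f - a * d\<^sup>2 - b * e\<^sup>2 - c * f\<^sup>2 = 1"
  shows "integer_gram a b c d e f"
  using assms
proof (induction "(nat a, nat (a * b - f\<^sup>2))" arbitrary: a b c d e f
    rule: wf_induct_rule[OF wf_lex_prod[OF wf_less_than wf_less_than]])
  case (1 a b f c d e)
  note IH = "1.hyps" and pos = "1.prems"(1,2) and det = "1.prems"(3)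
  define A where "A = a * b - f\<^sup>2"
  have A: "A > 0" using pos A_def by simp
  \<comment> \<open>Adding \<open>k\<close> times the second basis vector to the third changes the
    minor \<open>a * d - e * f\<close> by \<open>k * A\<close>, so it can be made at most
    \<open>A / 2\<close> in absolute value.\<close>
  obtain k where k: "2 * \<bar>(a * d - e * f) + k * A\<bar> \<le> A"
    using exists_nearest_multiple[OF A] by blast
  define c' d' e' where "c' = c + 2 * k * d + k\<^sup>2 * b" and "d' = d + k * b" and "e' = e + k * f"
  have det': "a * b * c' + 2 * d' * e' * f - a * d'\<^sup>2 - b * e'\<^sup>2 - c' * f\<^sup>2 = 1"
    using det unfolding c'_def d'_def e'_def by (simp add: power2_eq_square algebra_simps)
  define F C where "F = a * d' - e' * f" and "C = a * c' - e'\<^sup>2"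
  have F: "2 * \<bar>F\<bar> \<le> A"
    using k unfolding F_def d'_def e'_def A_def by (simp add: algebra_simps power2_eq_square)
  \<comment> \<open>Sylvester's identity: the minors bordering \<open>a\<close> form a binary form
    whose determinant is \<open>a\<close> times the full determinant.\<close>
  have "A * C - F\<^sup>2 = a * (a * b * c' + 2 * d' * e' * f - a * d'\<^sup>2 - b * e'\<^sup>2 - c' * f\<^sup>2)"
    unfolding A_def C_def F_def by (simp add: power2_eq_square algebra_simps)
  hence ACF: "A * C - F\<^sup>2 = a" using det' by simp
  have C: "C > 0"
  proof (rule ccontr)
    assume "\<not> C > 0"
    hence "A * C \<le> 0" using A by (simp add: mult_le_0_iff)
    thus False using ACF pos(1) zero_le_power2[of F] by linarith
  qed
  have "integer_gram a b c' d' e' f"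
  proof (cases "C < A")
    \<comment> \<open>Swapping the last two basis vectors keeps \<open>a\<close> and replaces the
      minor \<open>A\<close> by the smaller \<open>C\<close>.\<close>
    case True
    have "integer_gram a c' b d' f e'"
    proof (rule IH)
      show "((nat a, nat (a * c' - e'\<^sup>2)), nat a, nat (a * b - f\<^sup>2)) \<in> less_than <*lex*> less_than"
        using True C unfolding C_def A_def by simp
      show "a > 0" by fact
      show "a * c' - e'\<^sup>2 > 0" using C C_def by simp
      show "a * c' * b + 2 * d' * f * e' - a * d'\<^sup>2 - c' * f\<^sup>2 - b * e'\<^sup>2 = 1"
        using det' by (simp add: algebra_simps)
    qed
    thus ?thesis by (rule integer_gram_swap_last)
  next
    case False
    \<comment> \<open>Without descent in the minor, \<open>3 * A\<^sup>2 \<le> 4 * a\<close>.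
      Without descent in \<open>a\<close>, also \<open>3 * a\<^sup>2 \<le> 4 * A\<close>. Together
      they give \<open>27 * a ^ 4 \<le> 64 * a\<close>, so \<open>a = 1\<close>, and then
      \<open>A = 1\<close>.\<close>
    have "4 * F\<^sup>2 \<le> A\<^sup>2"
      using power_mono[OF F, of 2] by (simp add: power_mult_distrib)
    moreover have "A\<^sup>2 \<le> A * C" using False A by (simp add: power2_eq_square)
    ultimately have A_le: "3 * A\<^sup>2 \<le> 4 * a" using ACF by linarith
    obtain j where j: "2 * \<bar>f + j * a\<bar> \<le> a"
      using exists_nearest_multiple[OF pos(1)] by blast
    define b2 d2 f2 where "b2 = b + 2 * j * f + j\<^sup>2 * a" and "d2 = d' + j * e'" and "f2 = f + j * a"
    have det2: "a * b2 * c' + 2 * d2 * e' * f2 - a * d2\<^sup>2 - b2 * e'\<^sup>2 - c' * f2\<^sup>2 = 1"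
        using det' unfolding b2_def d2_def f2_def by (simp add: power2_eq_square algebra_simps)
    have A2: "A = a * b2 - f2\<^sup>2" unfolding A_def b2_def f2_def by (simp add: power2_eq_square algebra_simps)
    have b2: "b2 > 0"
    proof (rule ccontr)
      assume "\<not> b2 > 0"
      hence "a * b2 \<le> 0" using pos by (simp add: mult_le_0_iff)
      thus False using A2 A zero_le_power2[of f2] by linarith
    qed
    have "integer_gram a b2 c' d2 e' f2"
    proof (cases "b2 < a")
      case True
      have "integer_gram b2 a c' e' d2 f2"
      proof (rule IH)
        show "((nat b2, nat (b2 * a - f2\<^sup>2)), nat a, nat (a * b - f\<^sup>2)) \<in> less_than <*lex*> less_than"
          using True pos by simp
        show "b2 > 0" by fact
        show "b2 * a - f2\<^sup>2 > 0" using A A2 by (simp add: mult.commute)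
        show "b2 * a * c' + 2 * e' * d2 * f2 - b2 * e'\<^sup>2 - a * d2\<^sup>2 - c' * f2\<^sup>2 = 1"
          using det2 by (simp add: algebra_simps)
      qed
      thus ?thesis by (rule integer_gram_swap_first)
    next
      case False
      have f2: "4 * f2\<^sup>2 \<le> a\<^sup>2"
        using power_mono[OF j, of 2] unfolding f2_def[symmetric] by (simp add: power_mult_distrib)
      moreover have "a\<^sup>2 \<le> a * b2" using False pos by (simp add: power2_eq_square)
      ultimately have A_ge: "3 * a\<^sup>2 \<le> 4 * A" using A2 by linarith
      have "a = 1"
      proof (rule ccontr)
        assume "a \<noteq> 1"
        hence a: "a \<ge> 2" using pos by simp
        have "(3 * a\<^sup>2)\<^sup>2 \<le> (4 * A)\<^sup>2" using A_ge by (intro power_mono) auto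
        hence "9 * a ^ 4 \<le> 16 * A\<^sup>2" by (simp add: power_mult_distrib)
        hence "27 * a ^ 4 \<le> 64 * a" using A_le by linarith
        moreover have "a ^ 4 \<ge> 8 * a"
          using power_mono[OF a, of 3] a by (simp add: power3_eq_cube power4_eq_xxxx)
        ultimately show False using a by linarith
      qed
      have "A = 1"
      proof (rule ccontr)
        assume "A \<noteq> 1"
        hence "A \<ge> 2" using A by simp
        hence "A\<^sup>2 \<ge> 4" using power_mono[of 2 A 2] by simp
        thus False using A_le \<open>a = 1\<close> by simp
      qed
      have "2 * \<bar>f2\<bar> \<le> 1" using j \<open>a = 1\<close> unfolding f2_def by simp
      hence "f2 = 0" by linarith
      have "b2 = 1" using A2 \<open>A = 1\<close> \<open>a = 1\<close> \<open>f2 = 0\<close> by simp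
      have "2 * \<bar>F\<bar> \<le> 1" using F \<open>A = 1\<close> by simp
      hence "F = 0" by linarith
      have "C = 1" using ACF \<open>F = 0\<close> \<open>A = 1\<close> \<open>a = 1\<close> by simp
      \<comment> \<open>For \<open>a = 1\<close> this makes \<open>d2\<close> equal to
        \<open>F\<close>, which is 0. The only entry left off the diagonal is \<open>e'\<close>,
        removed by one more shear, which leaves the identity matrix.\<close>
      have "j = - f" using \<open>f2 = 0\<close> \<open>a = 1\<close> unfolding f2_def by simp
      hence "d2 = 0" using \<open>F = 0\<close> \<open>a = 1\<close> unfolding F_def d2_def by simp
      have "integer_gram a b2 (c' + 2 * (- e') * e' + (- e')\<^sup>2 * a) (d2 + (- e') * f2) (e' + (- e') * a) f2"
        using \<open>C = 1\<close> \<open>d2 = 0\<close> \<open>b2 = 1\<close> \<open>a = 1\<close> \<open>f2 = 0\<close>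
        by (intro integer_gramI[of 1 0 0 _ 0 1 0 _ 0 0 1])
          (auto simp: C_def power2_eq_square algebra_simps)
      thus ?thesis by (rule integer_gram_shear_third)
    qed
    thus ?thesis unfolding b2_def d2_def f2_def by (rule integer_gram_shear_second)
  qed
  thus ?case unfolding c'_def d'_def e'_def by (rule integer_gram_shear_third_second)
qed

section \<open>Sums of three squares\<close>

lemma Legendre_range: "Legendre a p \<in> {-1, 0, 1}"
  by (simp add: Legendre_def)

lemma Legendre_cong: "[a = b] (mod p) \<Longrightarrow> Legendre a p = Legendre b p"
proof -
  assume ab: "[a = b] (mod p)"
  have "[x = a] (mod p) \<longleftrightarrow> [x = b] (mod p)" "[a = x] (mod p) \<longleftrightarrow> [b = x] (mod p)" for x
    using ab by (metis cong_sym cong_trans)+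
  thus ?thesis unfolding Legendre_def QuadRes_def by (simp only:)
qed

lemma sign_eq_if_cong:
  fixes x y :: int
  assumes "[x = y] (mod p)" "x \<in> {-1, 0, 1}" "y \<in> {-1, 0, 1}" "p > 2"
  shows "x = y"
proof (rule ccontr)
  assume "x \<noteq> y"
  moreover have "p dvd \<bar>x - y\<bar>" using assms(1) by (simp add: cong_iff_dvd_diff)
  ultimately have "p \<le> \<bar>x - y\<bar>" by (intro zdvd_imp_le) auto
  thus False using assms(2-4) by auto
qed

lemma Legendre_mult:
  assumes "prime p" "p > 2"
  shows "Legendre (a * b) (int p) = Legendre a (int p) * Legendre b (int p)"
proof -
  let ?k = "(p - 1) div 2"
  have "[Legendre a p * Legendre b p = a ^ ?k * b ^ ?k] (mod p)"
    by (intro cong_mult euler_criterion assms)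
  hence "[Legendre (a * b) p = Legendre a p * Legendre b p] (mod p)"
    using euler_criterion[OF assms, of "a * b"] by (metis cong_sym cong_trans power_mult_distrib)
  thus ?thesis
    using Legendre_range[of "a * b" p] Legendre_range[of a p] Legendre_range[of b p] assms(2)
    by (intro sign_eq_if_cong[of _ _ "int p"]) auto
qed

lemma Legendre_one:
  assumes "p > 1"
  shows "Legendre 1 (int p) = 1"
proof -
  have "\<not> [1 = 0] (mod int p)" using assms by (simp add: cong_def)
  moreover have "QuadRes (int p) 1" unfolding QuadRes_def by (rule exI[of _ 1]) simp
  ultimately show ?thesis by (simp add: Legendre_def)
qed

lemma Legendre_eq_1_iff: "Legendre a p = 1 \<longleftrightarrow> \<not> [a = 0] (mod p) \<and> QuadRes p a"
  by (simp add: Legendre_def)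

text \<open>If all nonzero residues were squares, squaring would be injective on them, but 1 and
  \<open>p - 1\<close> have the same square.\<close>

lemma exists_quadratic_nonresidue:
  assumes "prime p" "p > 2"
  shows "\<exists>a::nat. Legendre (int a) (int p) = -1"
proof (rule ccontr)
  assume contr: "\<not> ?thesis"
  have "{1..<p} \<subseteq> (\<lambda>y. y\<^sup>2 mod p) ` {1..<p}"
  proof
    fix a assume a: "a \<in> {1..<p}"
    have "\<not> [int a = 0] (mod int p)" using a by (auto simp: cong_def)
    moreover have "Legendre (int a) (int p) \<noteq> -1" using contr by blast
    ultimately obtain y where y: "[y\<^sup>2 = int a] (mod int p)"
      unfolding Legendre_def QuadRes_def by (auto split: if_splits)
    define z where "z = nat (y mod int p)"
    have "int z = y mod int p" unfolding z_def using assms by simp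
    hence "int (z\<^sup>2 mod p) = y\<^sup>2 mod int p" by (simp add: zmod_int power_mod)
    also have "\<dots> = int a" using y a by (simp add: cong_def)
    finally have "a = z\<^sup>2 mod p" by simp
    moreover have "z \<noteq> 0" using calculation a by (intro notI) simp
    moreover have "z < p" unfolding z_def using assms by (simp add: nat_less_iff)
    ultimately show "a \<in> (\<lambda>y. y\<^sup>2 mod p) ` {1..<p}" by auto
  qed
  hence inj: "inj_on (\<lambda>y. y\<^sup>2 mod p) {1..<p}"
    using eq_card_imp_inj_on card_mono card_image_le
    by (metis finite_atLeastLessThan finite_imageI le_antisym)
  have "(p - 1)\<^sup>2 mod p = 1\<^sup>2 mod p"
  proof -
    have "(p - 1)\<^sup>2 = p * (p - 2) + 1"
      using assms by (cases p; cases "p - 1") (auto simp: power2_eq_square algebra_simps)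
    thus ?thesis by (metis mod_mult_self4 one_power2)
  qed
  hence "p - 1 = 1" by (rule inj_onD[OF inj]) (use assms in auto)
  thus False using assms by simp
qed

lemma Legendre_minus_one:
  assumes "prime p" "p > 2"
  shows "Legendre (-1) (int p) = (-1) ^ ((p - 1) div 2)"
proof (rule sign_eq_if_cong)
  show "[Legendre (-1) (int p) = (-1) ^ ((p - 1) div 2)] (mod int p)"
    by (rule euler_criterion[OF assms])
  show "(-1 :: int) ^ ((p - 1) div 2) \<in> {-1, 0, 1}" by (cases "even ((p - 1) div 2)") auto
qed (use assms Legendre_range in auto)

text \<open>For \<open>q = 8 * k + 3\<close> both 2 and -1 are nonresidues, the former by Gauss's
  lemma.\<close>

lemma Legendre_minus_two:
  assumes "prime q" "q mod 8 = 3"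
  shows "Legendre (-2) (int q) = 1"
proof -
  obtain k where k: "q = 8 * k + 3" using assms(2) by (metis mult_div_mod_eq)
  have q: "q > 2" using k by simp
  interpret GAUSS q 2
    using assms q by unfold_locales (auto simp: cong_0_iff dest: zdvd_imp_le)
  have "C = B"
    unfolding C_def B_def A_def unfolding k by (force simp: image_iff)
  \<comment> \<open>Half of \<open>q - 1\<close> is \<open>4 * k + 1\<close>, so the doubles
    exceeding it are those of \<open>2 * k + 1\<close> up to \<open>4 * k + 1\<close>, an odd number
    of them.\<close>
  hence "E = (\<lambda>j. 2 * j) ` {2 * int k + 1..4 * int k + 1}"
    unfolding E_def B_def A_def unfolding k by (auto simp: image_iff)
  hence "card E = card {2 * int k + 1..4 * int k + 1}"
    by (simp add: card_image inj_on_def)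
  hence "card E = 2 * k + 1" by simp
  hence "Legendre 2 (int q) = -1" using gauss_lemma by simp
  moreover have "(q - 1) div 2 = 2 * (2 * k) + 1" unfolding k by simp
  hence "Legendre (-1) (int q) = -1"
    unfolding Legendre_minus_one[OF assms(1) q] by simp
  ultimately show ?thesis using Legendre_mult[OF assms(1) q, of "-1" 2] by simp
qed

text \<open>As \<open>(q - 1) div 2\<close> is odd, the sign in quadratic reciprocity is the
  Legendre symbol of -1 modulo \<open>p\<close>.\<close>

lemma Legendre_reciprocal_minus:
  assumes "prime p" "prime q" "p > 2" "q mod 4 = 3" "p \<noteq> q"
  shows "Legendre (int p) (int q) = Legendre (- int q) (int p)"
proof -
  have q: "q > 2" using prime_ge_2_nat[OF assms(2)] assms(4) by (cases "q = 2") auto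
  have odd: "odd ((q - 1) div 2)" using assms(4) by presburger
  have "Legendre (int p) (int q) * Legendre (int q) (int p) = (-1) ^ ((p - 1) div 2 * ((q - 1) div 2))"
    by (intro Quadratic_Reciprocity assms q)
  also have "\<dots> = ((-1) ^ ((q - 1) div 2)) ^ ((p - 1) div 2)" by (subst mult.commute) (rule power_mult)
  also have "\<dots> = Legendre (-1) (int p)" using odd Legendre_minus_one[OF assms(1,3)] by simp
  finally have *: "Legendre (int p) (int q) * Legendre (int q) (int p) = Legendre (-1) (int p)" .
  have "\<not> [int q = 0] (mod int p)"
    using assms primes_dvd_imp_eq[of p q] by (auto simp: cong_0_iff)
  hence "Legendre (int q) (int p) * Legendre (int q) (int p) = 1"
    by (simp add: Legendre_def)
  moreover have "Legendre (- int q) (int p) = Legendre (-1) (int p) * Legendre (int q) (int p)"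
    using Legendre_mult[OF assms(1,3), of "-1" "int q"] by simp
  ultimately show ?thesis unfolding *[symmetric] by (simp add: mult.assoc)
qed

text \<open>Primes are added one at a time: by the Chinese remainder theorem for a new prime, by
  Hensel lifting for a repeated one.\<close>

lemma QuadRes_if_prime_factors:
  fixes m :: nat and a :: int
  assumes "odd m" "\<And>p. prime p \<Longrightarrow> p dvd m \<Longrightarrow> Legendre a (int p) = 1"
  shows "QuadRes (int m) a"
  using assms
proof (induction m rule: less_induct)
  case (less m)
  show ?case
  proof (cases "m = 1")
    case True
    thus ?thesis by (simp add: QuadRes_def)
  next
    case False
    then obtain p where p: "prime p" "p dvd m" using prime_factor_nat by blast
    then obtain k where k: "m = p * k" by (elim dvdE)
    have "odd p" "odd k" using less.prems(1) k by auto
    have "k > 0" "k < m" using \<open>odd k\<close> k prime_gt_1_nat[OF p(1)] by (auto intro: odd_pos)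
    have a: "\<not> int p dvd a" "QuadRes (int p) a"
      using less.prems(2)[OF p] by (simp_all add: Legendre_eq_1_iff cong_0_iff)
    have "QuadRes (int k) a"
      using less.IH[OF \<open>k < m\<close> \<open>odd k\<close>] less.prems(2) unfolding k by auto
    then obtain x where x: "[x\<^sup>2 = a] (mod int k)" unfolding QuadRes_def by blast
    have "\<exists>y. [y\<^sup>2 = a] (mod int (p * k))"
    proof (cases "p dvd k")
      case False
      hence c: "coprime (int p) (int k)" using p(1) by (simp add: prime_imp_coprime)
      obtain z where z: "[z\<^sup>2 = a] (mod int p)" using a unfolding QuadRes_def by blast
      obtain y where y: "[y = z] (mod int p)" "[y = x] (mod int k)"
        using binary_chinese_remainder_int[OF c] by blast
      have "[y\<^sup>2 = a] (mod int p)" "[y\<^sup>2 = a] (mod int k)"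
        using cong_trans[OF cong_pow[OF y(1)] z] cong_trans[OF cong_pow[OF y(2)] x] .
      hence "[y\<^sup>2 = a] (mod int p * int k)"
        using c by (intro coprime_cong_mult)
      thus ?thesis by auto
    next
      case True
      obtain j where j: "x\<^sup>2 = a + int k * j"
        using x by (metis cong_iff_lin cong_sym)
      have "\<not> int p dvd x"
      proof
        assume "int p dvd x"
        hence "int p dvd x\<^sup>2" by (simp add: power2_eq_square)
        moreover have "int p dvd int k * j" using True by simp
        ultimately have "int p dvd a" using j by (metis dvd_add_left_iff)
        thus False using a(1) by simp
      qed
      moreover have "\<not> int p dvd 2"
        using \<open>odd p\<close> p(1) by (metis dvd_refl int_dvd_int_iff of_nat_numeral primes_dvd_imp_eq two_is_prime_nat even_numeral)
      ultimately have "coprime (2 * x) (int p)"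
        using p(1) by (metis coprime_commute prime_dvd_mult_iff prime_imp_coprime prime_nat_int_transfer)
      then obtain i where i: "[2 * x * i = 1] (mod int p)" using cong_solve_coprime_int by blast
      \<comment> \<open>Newton step for the root \<open>x\<close> of \<open>x\<^sup>2 = a\<close>
        modulo \<open>k\<close>, with \<open>i\<close> inverse to \<open>2 * x\<close> modulo
        \<open>p\<close>.\<close>
      define y where "y = x - int k * (i * j)"
      have "int p dvd 1 - 2 * x * i" using i by (metis cong_iff_dvd_diff cong_sym)
      hence "int p * int k dvd (1 - 2 * x * i) * int k" by (intro mult_dvd_mono) auto
      moreover have "int p * int k dvd int k * int k" using True by (intro mult_dvd_mono) auto
      ultimately have "int p * int k dvd (1 - 2 * x * i) * int k * j + int k * int k * (i * j)\<^sup>2"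
        using dvd_mult2 by (intro dvd_add) blast+
      also have "\<dots> = y\<^sup>2 - a"
        unfolding y_def using j by (simp add: power2_eq_square algebra_simps)
      finally show ?thesis by (auto simp: cong_iff_dvd_diff)
    qed
    thus ?thesis unfolding QuadRes_def k .
  qed
qed

text \<open>The matrix with rows \<open>(n, b, 0)\<close>, \<open>(b, c, s)\<close>,
  \<open>(0, s, e)\<close>, where \<open>n * c - b\<^sup>2 = q\<close> and
  \<open>q * e - n * s\<^sup>2 = 1\<close>, has determinant 1. It is therefore the Gram matrix of
  integer vectors, the first of which has norm \<open>n\<close>.\<close>

lemma primitive_three_squares_if_prime:
  fixes n q b t :: int
  assumes "n > 0" "prime q" "[b\<^sup>2 = - q] (mod n)" "[t\<^sup>2 = - n] (mod q)" "\<not> q dvd n"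
  shows "\<exists>u v w. u\<^sup>2 + v\<^sup>2 + w\<^sup>2 = n \<and> gcd u (gcd v w) = 1"
proof -
  have q: "q > 0" using assms(2) prime_gt_0_int by blast
  obtain c where c: "b\<^sup>2 + q = n * c" using assms(3) by (auto simp: cong_iff_dvd_diff elim: dvdE)
  have "\<not> q dvd t"
  proof
    assume "q dvd t"
    hence "q dvd t\<^sup>2" by (simp add: power2_eq_square)
    moreover have "q dvd t\<^sup>2 + n" using assms(4) by (simp add: cong_iff_dvd_diff)
    ultimately show False using assms(5) by (simp add: dvd_add_right_iff)
  qed
  hence "coprime t q" using assms(2) by (metis coprime_commute prime_imp_coprime)
  \<comment> \<open>With \<open>s\<close> inverse to \<open>t\<close>, the congruence for
    \<open>t\<close> says that \<open>q\<close> divides \<open>1 + n * s\<^sup>2\<close>, which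
    provides \<open>e\<close>.\<close>
  then obtain s where s: "[t * s = 1] (mod q)" using cong_solve_coprime_int by blast
  have "[t\<^sup>2 * s\<^sup>2 = 1] (mod q)" using cong_pow[OF s, of 2] by (simp add: power_mult_distrib)
  moreover have "[t\<^sup>2 * s\<^sup>2 = - n * s\<^sup>2] (mod q)" using assms(4) by (rule cong_mult) simp
  ultimately have "[1 = - n * s\<^sup>2] (mod q)" by (metis cong_sym cong_trans)
  then obtain e where e: "1 + n * s\<^sup>2 = q * e" by (auto simp: cong_iff_dvd_diff elim: dvdE)
  have q_eq: "n * c - b\<^sup>2 = q" using c by simp
  have det: "n * c * e + 2 * s * 0 * b - n * s\<^sup>2 - c * 0\<^sup>2 - e * b\<^sup>2 = 1"
  proof -
    have "n * c * e - n * s\<^sup>2 - e * b\<^sup>2 = (n * c - b\<^sup>2) * e - n * s\<^sup>2" by (simp add: algebra_simps)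
    thus ?thesis using e q_eq by simp
  qed
  have "integer_gram n c e s 0 b"
    by (rule integer_gram_if_det_one) (use assms(1) q q_eq det in auto)
  then obtain u1 u2 u3 v1 v2 v3 where u: "u1 * u1 + u2 * u2 + u3 * u3 = n" 
    and v: "u1 * v1 + u2 * v2 + u3 * v3 = b"
    unfolding integer_gram_def by blast
  define g where "g = gcd u1 (gcd u2 u3)"
  have g: "g dvd u1" "g dvd u2" "g dvd u3" unfolding g_def by (auto intro: dvd_trans)
  have "g dvd n" unfolding u[symmetric] using g by auto
  moreover have "g dvd b" unfolding v[symmetric] using g by auto
  \<comment> \<open>A common divisor of the coordinates of \<open>u\<close> divides the first row of
    the Gram matrix, hence its determinant.\<close>
  ultimately have "g dvd n * (c * e - s\<^sup>2) - b * (e * b)" by auto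
  also have "\<dots> = 1" using det by (simp add: power2_eq_square algebra_simps)
  finally have "g = 1" unfolding g_def by simp
  thus ?thesis using u unfolding g_def power2_eq_square
    by (intro exI[of _ u1] exI[of _ u2] exI[of _ u3]) simp
qed

section \<open>Existence of the auxiliary prime q\<close>

lemma Legendre_period: "p dvd N \<Longrightarrow> Legendre (int (n + N)) (int p) = Legendre (int n) (int p)"
  by (rule Legendre_cong) (auto simp: cong_iff_dvd_diff)

lemma real_character_Legendre:
  assumes "prime p" "p > 2"
  shows "real_character (\<lambda>n. real_of_int (Legendre (int n) (int p)))"
proof
  show "real_of_int (Legendre (int n) (int p)) \<in> {-1, 0, 1}" for n
    using Legendre_range[of "int n" "int p"] by auto
qed (use assms in \<open>simp_all add: Legendre_one Legendre_mult\<close>)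

text \<open>The lists tabulate, on odd residues modulo 8, the quadratic characters belonging to -1
  and to 2.\<close>

lemma real_character_mod_8:
  assumes xs: "xs \<in> {[0, 1, 0, -1, 0, 1, 0, -1], [0, 1, 0, -1, 0, -1, 0, 1]}"
  shows "real_character (\<lambda>n. xs ! (n mod 8))"
proof
  have cases8: "i = 0 \<or> i = 1 \<or> i = 2 \<or> i = 3 \<or> i = 4 \<or> i = 5 \<or> i = 6 \<or> i = 7" if "i < 8" for i :: nat
    using that by presburger
  have nth_mult: "xs ! (i * j mod 8) = xs ! i * xs ! j" if "i < 8" "j < 8" for i j
    using xs cases8[OF that(1)] cases8[OF that(2)] by (elim insertE emptyE disjE) simp_all
  show "xs ! (m * n mod 8) = xs ! (m mod 8) * xs ! (n mod 8)" for m n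
    using nth_mult[of "m mod 8" "n mod 8"] by (simp add: mod_mult_eq)
  show "xs ! (n mod 8) \<in> {-1, 0, 1}" for n
    using xs cases8[of "n mod 8"] by (elim insertE emptyE disjE) auto
  show "xs ! (1 mod 8) = 1" using xs by auto
qed

text \<open>Every condition prescribes a real character at \<open>q\<close>: both characters modulo
  8 equal -1 exactly for \<open>q mod 8 = 3\<close>, and the symbol of \<open>- q\<close> modulo
  \<open>p\<close> is 1 if that of \<open>q\<close> agrees with that of -1. Independence of the
  characters comes from the Chinese remainder theorem.\<close>

lemma exists_prime_with_residues:
  fixes m :: nat
  assumes "odd m"
  shows "\<exists>q. prime q \<and> q mod 8 = 3 \<and> (\<forall>p. prime p \<and> p dvd m \<longrightarrow> Legendre (- int q) (int p) = 1)"
proof -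
  define P where "P = {p. prime p \<and> p dvd m}"
  have "m > 0" using assms by (rule odd_pos)
  have finP: "finite P" using finite_divisors_nat[OF \<open>m > 0\<close>] unfolding P_def by simp
  have P: "prime p" "p > 2" "odd p" if "p \<in> P" for p
  proof -
    show "prime p" using that P_def by simp
    show "odd p" using that assms unfolding P_def by auto
    thus "p > 2" using prime_ge_2_nat[OF \<open>prime p\<close>] by (cases "p = 2") auto
  qed
  define c4 c8 :: "nat \<Rightarrow> real" where "c4 n = [0, 1, 0, -1, 0, 1, 0, -1] ! (n mod 8)"
    and "c8 n = [0, 1, 0, -1, 0, -1, 0, 1] ! (n mod 8)" for n
  \<comment> \<open>The indices 4 and 8 are not prime and stand for the two characters modulo 8.\<close>
  define f where "f i = (if i = 4 then c4 else if i = 8 then c8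
    else (\<lambda>n. real_of_int (Legendre (int n) (int i))))" for i
  define \<epsilon> where "\<epsilon> i = (if i = 4 \<or> i = 8 then - 1 else real_of_int (Legendre (- 1) (int i)))" for i :: nat
  define I where "I = {4, 8} \<union> P"
  define N where "N = 8 * \<Prod>P"
  have notin: "4 \<notin> P" "8 \<notin> P" using P(3)[of 4] P(3)[of 8] by auto
  have f_P: "f p = (\<lambda>n. real_of_int (Legendre (int n) (int p)))" if "p \<in> P" for p
    using that notin unfolding f_def by auto
  have f_48: "f 4 = c4" "f 8 = c8" unfolding f_def by simp_all
  have char: "real_character (f i)" if "i \<in> I" for i
  proof -
    have "real_character c4" "real_character c8"
      unfolding c4_def c8_def by (rule real_character_mod_8; simp)+
    thus ?thesis using that f_P f_48 real_character_Legendre P unfolding I_def by auto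
  qed
  have "infinite {p. prime p \<and> (\<forall>i\<in>I. f i p = \<epsilon> i)}"
  proof (rule infinite_primes_prescribed_characters)
    show "finite I" unfolding I_def using finP by simp
    show "N > 0" unfolding N_def using P prime_gt_0_nat by (auto intro!: prod_pos)
    show "f i (n + N) = f i n" if "i \<in> I" for i n
    proof -
      have "(n + N) mod 8 = n mod 8" unfolding N_def by simp
      moreover have "i dvd N" if "i \<in> P" for i
        unfolding N_def using that finP by (intro dvd_mult dvd_prodI[of P i "\<lambda>x. x"])
      ultimately show ?thesis
        using that f_48 f_P Legendre_period[of i N n] unfolding I_def c4_def c8_def by auto
    qed
    show "\<epsilon> i \<in> {-1, 1}" if "i \<in> I" for i
    proof (cases "i \<in> P")
      case True
      hence "Legendre (-1) (int i) \<in> {-1, 1}"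
        using Legendre_minus_one[of i] P by (cases "even ((i - 1) div 2)") auto
      thus ?thesis unfolding \<epsilon>_def by auto
    qed (use that in \<open>auto simp: \<epsilon>_def I_def\<close>)
    show "\<exists>a. coprime a N \<and> (\<Prod>i\<in>S. f i a) = -1" if S: "S \<subseteq> I" "S \<noteq> {}" for S
    proof (cases "S \<inter> P = {}")
      case False
      then obtain p where p: "p \<in> S" "p \<in> P" by blast
      \<comment> \<open>A number congruent to a nonresidue modulo \<open>p\<close> and to 1 modulo
        \<open>M\<close> has value -1 under the character of \<open>p\<close> and 1 under all others
        in \<open>S\<close>.\<close>
      obtain g where g: "Legendre (int g) (int p) = -1"
        using exists_quadratic_nonresidue P p by blast
      define M where "M = 8 * \<Prod>(P - {p})"
      have N: "N = p * M"
        unfolding N_def M_def using finP p by (simp add: prod.remove[of P p] mult_ac)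
      have "coprime p (8 :: nat)"
        using P(3)[OF p(2)] coprime_power_right_iff[of p 2 3] by simp
      moreover have "coprime p (\<Prod>(P - {p}))"
        using P p by (intro prod_coprime_right) (auto intro: primes_coprime)
      ultimately have "coprime p M" unfolding M_def by simp
      then obtain a where a: "[a = g] (mod p)" "[a = 1] (mod M)"
        using binary_chinese_remainder_nat by blast
      have "a mod 8 = 1"
        using cong_dvd_modulus_nat[OF a(2), of 8] unfolding M_def by (simp add: cong_def)
      hence "f 4 a = 1" "f 8 a = 1" unfolding f_48 c4_def c8_def by simp_all
      moreover have "f r a = 1" if "r \<in> P - {p}" for r
      proof -
        have "r dvd M" unfolding M_def
          using that finP by (intro dvd_mult dvd_prodI[of "P - {p}" r "\<lambda>x. x"]) auto
        hence "[a = 1] (mod r)" using a(2) cong_dvd_modulus_nat by blast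
        hence "[int a = 1] (mod int r)" by (simp flip: cong_int_iff)
        hence "Legendre (int a) (int r) = Legendre 1 (int r)" by (rule Legendre_cong)
        thus ?thesis using f_P that P[of r] Legendre_one[of r] by auto
      qed
      ultimately have "f i a = 1" if "i \<in> S - {p}" for i using S(1) that unfolding I_def by auto
      moreover have "f p a = -1"
      proof -
        have "[int a = int g] (mod int p)" using a(1) by (simp add: cong_int_iff)
        thus ?thesis using f_P[OF p(2)] g Legendre_cong by simp
      qed
      ultimately have "(\<Prod>i\<in>S. f i a) = -1"
        using p(1) finite_subset[OF S(1)] finP unfolding I_def
        by (subst prod.remove[of S p]) auto
      moreover have "coprime a p"
      proof -
        have "\<not> p dvd g" using g by (auto simp: Legendre_def cong_0_iff split: if_splits)
        hence "\<not> p dvd a" using a(1) cong_dvd_iff by blast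
        with P(1)[OF p(2)] have "coprime p a" by (rule prime_imp_coprime)
        thus ?thesis by (simp add: coprime_commute)
      qed
      moreover have "coprime a M" using a(2) by (metis cong_imp_coprime cong_sym coprime_1_left)
      ultimately show ?thesis unfolding N by auto
    next
      case True
      hence S48: "S = {4} \<or> S = {8} \<or> S = {4, 8}" using S unfolding I_def by auto
      \<comment> \<open>Both characters modulo 8 are -1 at 3, so 3 serves a single one; at 5 exactly
        one is -1, so 5 serves their product.\<close>
      define b :: nat where "b = (if S = {4, 8} then 5 else 3)"
      have "coprime 8 (\<Prod>P)"
      proof (rule prod_coprime_right)
        fix p assume "p \<in> P"
        thus "coprime 8 p" using P(3) coprime_power_left_iff[of 2 3 p] by simp
      qed
      then obtain a where a: "[a = b] (mod 8)" "[a = 1] (mod \<Prod>P)"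
        using binary_chinese_remainder_nat by blast
      have "a mod 8 = b" using a(1) unfolding b_def by (simp add: cong_def)
      hence "(\<Prod>i\<in>S. f i a) = -1"
        using S48 unfolding b_def by (auto simp: f_48 c4_def c8_def doubleton_eq_iff)
      moreover have "odd b" unfolding b_def by simp
      hence "odd a" using \<open>a mod 8 = b\<close> by presburger
      hence "coprime a 8" using coprime_power_right_iff[of a 2 3] by simp
      moreover have "coprime a (\<Prod>P)" using a(2) by (metis cong_imp_coprime cong_sym coprime_1_left)
      ultimately show ?thesis unfolding N_def by auto
    qed
  qed (fact char)
  then obtain q where q: "prime q" "\<And>i. i \<in> I \<Longrightarrow> f i q = \<epsilon> i"
    using infinite_imp_nonempty by blast
  have "c4 q = -1" "c8 q = -1"
    using q(2)[of 4] q(2)[of 8] f_48 unfolding I_def \<epsilon>_def by auto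
  moreover have "q mod 8 < 8" by simp
  hence "q mod 8 = 0 \<or> q mod 8 = 1 \<or> q mod 8 = 2 \<or> q mod 8 = 3 \<or> q mod 8 = 4 \<or> q mod 8 = 5 \<or>
      q mod 8 = 6 \<or> q mod 8 = 7" by presburger
  ultimately have "q mod 8 = 3" unfolding c4_def c8_def by auto
  moreover have "Legendre (- int q) (int p) = 1" if "prime p" "p dvd m" for p
  proof -
    have p: "p \<in> P" using that P_def by simp
    have "Legendre (int q) (int p) = Legendre (-1) (int p)"
      using q(2)[of p] p f_P[OF p] notin unfolding I_def \<epsilon>_def by (auto split: if_splits)
    moreover have "Legendre (-1) (int p) \<in> {-1, 1}"
      using Legendre_minus_one[of p] P[OF p] by (cases "even ((p - 1) div 2)") auto
    ultimately show ?thesis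
      using Legendre_mult[OF P(1,2)[OF p], of "-1" "int q"] by auto
  qed
  ultimately show ?thesis using q(1) by blast
qed

text \<open>For \<open>n = 2 * m\<close>, reciprocity turns the conditions on \<open>- q\<close>
  modulo the primes dividing \<open>m\<close> into the statement that \<open>m\<close> is a square
  modulo \<open>q\<close>; since -2 is one too, so is \<open>- n\<close>.\<close>

theorem primitive_three_squares_twice_odd:
  fixes m :: nat
  assumes "odd m"
  shows "\<exists>u v w :: int. u\<^sup>2 + v\<^sup>2 + w\<^sup>2 = 2 * int m \<and> gcd u (gcd v w) = 1"
proof -
  obtain q where q: "prime q" "q mod 8 = 3"
    and res: "\<And>p. prime p \<Longrightarrow> p dvd m \<Longrightarrow> Legendre (- int q) (int p) = 1"
    using exists_prime_with_residues[OF assms] by blast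
  have q2: "q > 2" using prime_ge_2_nat[OF q(1)] q(2) by (cases "q = 2") auto
  have q4: "q mod 4 = 3" using q(2) by presburger
  have "odd q" using q4 by presburger
  obtain x where x: "[x\<^sup>2 = - int q] (mod int m)"
    using QuadRes_if_prime_factors[OF assms res] unfolding QuadRes_def by blast
  \<comment> \<open>An odd root also satisfies the congruence modulo 2, since \<open>q\<close> is
    odd.\<close>
  define b where "b = (if odd x then x else x + int m)"
  have "odd b" unfolding b_def using assms by simp
  hence "[b\<^sup>2 = - int q] (mod 2)" using \<open>odd q\<close> by (simp add: cong_iff_dvd_diff)
  moreover have "[b = x] (mod int m)" unfolding b_def by (simp add: cong_def)
  hence "[b\<^sup>2 = - int q] (mod int m)" using x by (metis cong_pow cong_trans)
  ultimately have b: "[b\<^sup>2 = - int q] (mod 2 * int m)"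
    using assms by (intro coprime_cong_mult) auto
  have "q \<noteq> p" if "prime p" "p dvd m" for p
    using res[OF that] by (auto simp: Legendre_def cong_0_iff)
  hence "Legendre (int p) (int q) = 1" if "prime p" "p dvd m" for p
    using Legendre_reciprocal_minus[of p q] that q(1) q4 res[OF that] assms prime_ge_2_nat[of p]
    by (cases "p = 2") auto
  hence "Legendre (int k) (int q) = 1" if "k dvd m" for k
    using that
  proof (induction k rule: prime_divisors_induct)
    case zero
    thus ?case using assms by simp
  next
    case (unit k)
    thus ?case using Legendre_one[of q] q2 by simp
  next
    case (factor p k)
    thus ?case using Legendre_mult[OF q(1) q2, of "int p" "int k"]
      by (metis dvd_mult_left dvd_mult_right mult_1 of_nat_mult)
  qed
  hence "Legendre (- 2 * int m) (int q) = 1"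
    using Legendre_mult[OF q(1) q2, of "-2" "int m"] Legendre_minus_two[OF q] by simp
  then obtain t where t: "[t\<^sup>2 = - (2 * int m)] (mod int q)" "\<not> int q dvd 2 * int m"
    unfolding Legendre_eq_1_iff QuadRes_def by (auto simp: cong_0_iff)
  show ?thesis
    by (rule primitive_three_squares_if_prime[OF _ _ b t]) (use assms q(1) odd_pos in auto)
qed

section \<open>The forms with coefficients 1, 3, 6 and 3, 4, 6\<close>

text \<open>\<open>Y\<^sup>2 + 2 * x\<^sup>2\<close> is the norm of
  \<open>Y + x * sqrt (-2)\<close>. A common factor 3 is replaced by the element
  \<open>-1 + 2 * sqrt (-2)\<close>, the square of \<open>1 + sqrt (-2)\<close>, which has the same
  norm 9 and preserves the parity of \<open>Y\<close>.\<close>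

lemma even_times_sqrt_minus_two_coprime_3:
  fixes Y x :: int
  assumes "even Y" "(Y, x) \<noteq> (0, 0)"
  shows "\<exists>Y' x'. even Y' \<and> \<not> (3 dvd Y' \<and> 3 dvd x') \<and> Y'\<^sup>2 + 2 * x'\<^sup>2 = Y\<^sup>2 + 2 * x\<^sup>2"
  using assms
proof (induction "nat (Y\<^sup>2 + 2 * x\<^sup>2)" arbitrary: Y x rule: less_induct)
  case (less Y x)
  show ?case
  proof (cases "3 dvd Y \<and> 3 dvd x")
    case False
    thus ?thesis using less.prems by blast
  next
    case True
    then obtain Z t where Z: "Y = 3 * Z" and t: "x = 3 * t" by (elim conjE dvdE)
    have "(Z, t) \<noteq> (0, 0)" "even Z" using less.prems Z t by auto
    moreover have "Z\<^sup>2 + 2 * t\<^sup>2 > 0"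
      using \<open>(Z, t) \<noteq> (0, 0)\<close> by (auto intro: add_pos_nonneg add_nonneg_pos)
    hence "nat (Z\<^sup>2 + 2 * t\<^sup>2) < nat (Y\<^sup>2 + 2 * x\<^sup>2)"
      unfolding Z t by (simp add: power_mult_distrib)
    ultimately obtain Y1 x1 where 1: "even Y1" "\<not> (3 dvd Y1 \<and> 3 dvd x1)"
      "Y1\<^sup>2 + 2 * x1\<^sup>2 = Z\<^sup>2 + 2 * t\<^sup>2"
      using less.hyps by blast
    \<comment> \<open>Replacing \<open>x1\<close> by \<open>- x1\<close> ensures that the product is
      not divisible by 3: \<open>Y1 + x1\<close> and \<open>Y1 - x1\<close> are not both multiples
      of 3.\<close>
    define s :: int where "s = (if 3 dvd Y1 + x1 then - 1 else 1)"
    have s: "s = 1 \<or> s = - 1" "\<not> 3 dvd Y1 + s * x1"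
      using 1(2) unfolding s_def by (auto, presburger+)
    have "\<not> 3 dvd - Y1 - 4 * (s * x1)" using s(2) by presburger
    moreover have "even (- Y1 - 4 * (s * x1))" using 1(1) by simp
    moreover have "(- Y1 - 4 * (s * x1))\<^sup>2 + 2 * (2 * Y1 - s * x1)\<^sup>2 = Y\<^sup>2 + 2 * x\<^sup>2"
    proof -
      have "(- Y1 - 4 * (s * x1))\<^sup>2 + 2 * (2 * Y1 - s * x1)\<^sup>2 = 9 * (Y1\<^sup>2 + 2 * x1\<^sup>2)"
        using s(1) by (auto simp: power2_eq_square algebra_simps)
      thus ?thesis unfolding 1(3) Z t by (simp add: power_mult_distrib)
    qed
    ultimately show ?thesis by blast
  qed
qed

lemma represents_3_4_6_if_1_3_6:
  fixes Z Y x :: int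
  assumes "\<not> 3 dvd Z" "even Y \<or> even Z" "(Y, x) \<noteq> (0, 0)"
  shows "\<exists>x' Y' Z'. 6 * x'\<^sup>2 + 3 * Y'\<^sup>2 + 4 * Z'\<^sup>2 = Z\<^sup>2 + 3 * Y\<^sup>2 + 6 * x\<^sup>2"
proof (cases "even Z")
  case True
  then obtain Z' where "Z = 2 * Z'" by (elim evenE)
  thus ?thesis by (intro exI[of _ x] exI[of _ Y] exI[of _ Z']) (simp add: power_mult_distrib)
next
  case False
  hence "even Y" using assms by simp
  then obtain Y1 x1 where 1: "even Y1" "\<not> (3 dvd Y1 \<and> 3 dvd x1)"
    "Y1\<^sup>2 + 2 * x1\<^sup>2 = Y\<^sup>2 + 2 * x\<^sup>2"
    using even_times_sqrt_minus_two_coprime_3 assms by blast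
  have "\<exists>s r. (s = 1 \<or> s = -1) \<and> (r = 1 \<or> r = -1) \<and> 3 dvd Z + s * Y1 + 2 * (r * x1)"
  proof -
    have "3 dvd Z + Y1 + 2 * x1 \<or> 3 dvd Z - Y1 + 2 * x1 \<or> 3 dvd Z + Y1 - 2 * x1 \<or> 3 dvd Z - Y1 - 2 * x1"
      using 1(2) assms(1) by presburger
    thus ?thesis by (elim disjE) (force)+
  qed
  then obtain s r k where s: "s = 1 \<or> s = -1" and r: "r = 1 \<or> r = -1"
    and k: "Z + s * Y1 + 2 * (r * x1) = 3 * k" by (elim exE conjE dvdE)
  \<comment> \<open>\<open>Z\<close> is odd and \<open>Y1\<close> even, so \<open>k\<close> is
    odd.\<close>
  have "even (Z - 3 * k)" using False 1(1) k s by (metis (full_types) even_add even_mult_iff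
     even_diff odd_numeral even_numeral)
  then obtain Z' where Z': "Z - 3 * k = 2 * Z'" by (elim evenE)
  \<comment> \<open>The inner product with \<open>(3, 1, 1)\<close> is \<open>9 * k\<close> and the
    norm of this vector is 18, so the reflection subtracts \<open>k * (3, 1, 1)\<close>.\<close>
  have "(Z - 3 * k)\<^sup>2 + 3 * (s * Y1 - k)\<^sup>2 + 6 * (r * x1 - k)\<^sup>2 =
        Z\<^sup>2 + 3 * (s * Y1)\<^sup>2 + 6 * (r * x1)\<^sup>2 - 6 * k * (Z + s * Y1 + 2 * (r * x1)) + 18 * k\<^sup>2"
    by (simp add: power2_eq_square algebra_simps)
  also have "\<dots> = Z\<^sup>2 + 3 * (s * Y1)\<^sup>2 + 6 * (r * x1)\<^sup>2"
    unfolding k by (simp add: power2_eq_square)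
  also have "\<dots> = Z\<^sup>2 + 3 * (Y1\<^sup>2 + 2 * x1\<^sup>2)"
    using s r by (auto simp: power_mult_distrib)
  also have "\<dots> = Z\<^sup>2 + 3 * Y\<^sup>2 + 6 * x\<^sup>2" using 1(3) by simp
  finally show ?thesis unfolding Z'
    by (intro exI[of _ "r * x1 - k"] exI[of _ "s * Y1 - k"] exI[of _ Z'])
      (simp add: power_mult_distrib)
qed

text \<open>\<open>6 * Q34_3 x y 1 w = 6 * x\<^sup>2 + 3 * (2 * y + 1)\<^sup>2 + 4 * (3 * w +
  1)\<^sup>2 + 17\<close>. Parity forces \<open>Y\<close> to be odd, and as 3 does not divide 17,
  \<open>Z\<close> has the form \<open>3 * w + 1\<close> up to sign.\<close>

lemma exists_Q34_3_with_z_eq_1: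
  fixes X Y Z n :: int
  assumes "6 * X\<^sup>2 + 3 * Y\<^sup>2 + 4 * Z\<^sup>2 = 6 * n - 17"
  shows "\<exists>x y w. Q34_3 x y 1 w = n"
proof -
  have "3 * Y\<^sup>2 = 2 * (3 * n - 9 - 3 * X\<^sup>2 - 2 * Z\<^sup>2) + 1" using assms by simp
  hence "odd (3 * Y\<^sup>2)" by presburger
  hence "odd Y" by simp
  then obtain y where y: "Y = 2 * y + 1" by (elim oddE)
  have "\<not> 3 dvd Z"
  proof
    assume "3 dvd Z"
    hence "3 dvd 4 * Z\<^sup>2 + 3 * (2 * X\<^sup>2 + Y\<^sup>2 - 2 * n)" by (simp add: power2_eq_square)
    moreover have "4 * Z\<^sup>2 + 3 * (2 * X\<^sup>2 + Y\<^sup>2 - 2 * n) = - 17" using assms by simp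
    ultimately show False by simp
  qed
  hence "\<exists>w. Z = 3 * w + 1 \<or> Z = - (3 * w + 1)" by presburger
  then obtain w where "Z = 3 * w + 1 \<or> Z = - (3 * w + 1)" ..
  hence w: "Z\<^sup>2 = (3 * w + 1)\<^sup>2" by (elim disjE) (simp_all only: power2_minus)
  have "6 * Q34_3 X y 1 w = 6 * n"
    using assms unfolding w y Q34_3_def by (simp add: power2_eq_square algebra_simps)
  thus ?thesis by auto
qed

text \<open>After sign changes and a cyclic permutation the vector lies in the lattice spanned by
  \<open>(1, -1, 0)\<close>, \<open>(1, 1, -2)\<close>, \<open>(2, 2, 2)\<close>; \<open>Z\<close>,
  \<open>Y\<close>, \<open>x\<close> are its coordinates there. Modulo 4 two entries are odd, and
  modulo 3 exactly one entry vanishes, so signs exist that make the sum of the entries divisible by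
  6.\<close>

lemma represents_1_3_6_if_three_squares:
  fixes a b c m :: int
  assumes "a\<^sup>2 + b\<^sup>2 + c\<^sup>2 = 2 * m" "[m = 1] (mod 6)" "gcd a (gcd b c) = 1" "m > 1"
  shows "\<exists>Z Y x. Z\<^sup>2 + 3 * Y\<^sup>2 + 6 * x\<^sup>2 = m \<and> (Y, x) \<noteq> (0, 0)"
proof -
  have m: "m mod 6 = 1" using assms(2) by (simp add: cong_def)
  have sq4: "t\<^sup>2 mod 4 = (if even t then 0 else 1)" for t :: int
  proof -
    have "t mod 4 = 0 \<or> t mod 4 = 1 \<or> t mod 4 = 2 \<or> t mod 4 = 3" by presburger
    moreover have "t\<^sup>2 mod 4 = ((t mod 4)\<^sup>2) mod 4" by (simp add: power_mod)
    moreover have "even t \<longleftrightarrow> even (t mod 4)" by presburger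
    ultimately show ?thesis by auto
  qed
  have sq3: "t\<^sup>2 mod 3 = (if 3 dvd t then 0 else 1)" for t :: int
  proof -
    have "t mod 3 = 0 \<or> t mod 3 = 1 \<or> t mod 3 = 2" by presburger
    moreover have "t\<^sup>2 mod 3 = ((t mod 3)\<^sup>2) mod 3" by (simp add: power_mod)
    moreover have "3 dvd t \<longleftrightarrow> t mod 3 = 0" by presburger
    ultimately show ?thesis by auto
  qed
  have main: "\<exists>Z Y x. Z\<^sup>2 + 3 * Y\<^sup>2 + 6 * x\<^sup>2 = m \<and> (Y, x) \<noteq> (0, 0)"
    if sum: "a\<^sup>2 + b\<^sup>2 + c\<^sup>2 = 2 * m" and g: "gcd a (gcd b c) = 1" and c: "even c" for a b c :: int
  proof -
    have "(a\<^sup>2 + b\<^sup>2 + c\<^sup>2) mod 4 = 2" using sum m by presburger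
    hence ab: "odd a" "odd b" using sq4[of a] sq4[of b] sq4[of c] c
      by (auto split: if_splits) presburger+
    have "(a\<^sup>2 + b\<^sup>2 + c\<^sup>2) mod 3 = 2" using sum m by presburger
    moreover have "(s + t + r) mod 3 = (s mod 3 + t mod 3 + r mod 3) mod 3" for s t r :: int
      by presburger
    ultimately have "(a\<^sup>2 mod 3 + b\<^sup>2 mod 3 + c\<^sup>2 mod 3) mod 3 = 2" by metis
    hence "3 dvd a \<and> \<not> 3 dvd b \<and> \<not> 3 dvd c \<or> \<not> 3 dvd a \<and> 3 dvd b \<and> \<not> 3 dvd c \<or>
           \<not> 3 dvd a \<and> \<not> 3 dvd b \<and> 3 dvd c"
      unfolding sq3 by (auto split: if_splits)
    hence "3 dvd a + b + c \<or> 3 dvd a - b + c \<or> 3 dvd a + b - c \<or> 3 dvd a - b - c" by presburger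
    hence "\<exists>r s. (r = 1 \<or> r = -1) \<and> (s = 1 \<or> s = - 1) \<and> 3 dvd a + r * b + s * c"
      by (elim disjE) force+
    then obtain r s :: int where r: "r = 1 \<or> r = -1" and s: "s = 1 \<or> s = -1"
      and d3: "3 dvd a + r * b + s * c" by blast
    have "2 dvd a + r * b + s * c" using ab c r s by auto
    hence "6 dvd a + r * b + s * c" using d3 divides_mult[of 2 "a + r * b + s * c" 3] by simp
    then obtain x where x: "a + r * b + s * c = 6 * x" by (elim dvdE)
    have "even (2 * x - s * c)" "even (a - r * b)" using ab c r s by auto
    then obtain Y Z where Y: "2 * x - s * c = 2 * Y" and Z: "a - r * b = 2 * Z"
      by (elim evenE)
    have "a + r * b = 4 * x + 2 * Y" using x Y by simp
    hence a': "a = 2 * x + Y + Z" and b': "r * b = 2 * x + Y - Z" using Z by simp_all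
    have c': "s * c = 2 * x - 2 * Y" using Y by simp
    have "2 * m = a\<^sup>2 + (r * b)\<^sup>2 + (s * c)\<^sup>2" using sum r s by auto
    hence "m = Z\<^sup>2 + 3 * Y\<^sup>2 + 6 * x\<^sup>2"
      unfolding a' b' c' by (simp add: power2_eq_square algebra_simps)
    \<comment> \<open>Otherwise the vector is a multiple of \<open>(1, -1, 0)\<close> up to signs,
      and primitivity forces \<open>m = 1\<close>.\<close>
    moreover have "(Y, x) \<noteq> (0, 0)"
    proof
      assume "(Y, x) = (0, 0)"
      hence 0: "Y = 0" "x = 0" by auto
      hence "c = 0" "a = Z" "b = Z \<or> b = - Z" using a' b' c' r s by auto
      hence "\<bar>Z\<bar> = 1" using g by auto
      hence "m = 1" using \<open>m = _\<close> 0 by (simp add: abs_square_eq_1)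
      thus False using assms(4) by simp
    qed
    ultimately show ?thesis by metis
  qed
  have "even a \<or> even b \<or> even c"
    using assms(1) by (metis even_add even_power zero_neq_numeral dvd_triv_left)
  moreover have "gcd b (gcd c a) = 1" "gcd c (gcd a b) = 1"
    using assms(3) by (metis gcd.assoc gcd.commute)+
  moreover have "b\<^sup>2 + c\<^sup>2 + a\<^sup>2 = 2 * m" "c\<^sup>2 + a\<^sup>2 + b\<^sup>2 = 2 * m"
    using assms(1) by simp_all
  ultimately show ?thesis
    using main[of a b c] main[of b c a] main[of c a b] assms(1,3) by argo
qed

theorem theorem4p1: "primitively_universal Q34_3"
  unfolding primitively_universal_def
proof (intro allI impI)
  fix n :: int assume "n > 0"
  \<comment> \<open>\<open>6 * n - 17\<close> is negative for \<open>n \<le> 2\<close> and equals 1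
    for \<open>n = 3\<close>, while the reduction requires \<open>m > 1\<close>.\<close>
  consider "n = 1" | "n = 2" | "n = 3" | "n \<ge> 4" using \<open>n > 0\<close> by linarith
  thus "\<exists>x y z w. Q34_3 x y z w = n \<and> Gcd {x, y, z, w} = 1"
  proof cases
    case 1
    thus ?thesis by (intro exI[of _ 1] exI[of _ 0]) (simp add: Q34_3_def)
  next
    case 2
    thus ?thesis by (intro exI[of _ 0] exI[of _ 1] exI[of _ 0]) (simp add: Q34_3_def)
  next
    case 3
    thus ?thesis by (intro exI[of _ 1] exI[of _ 1] exI[of _ 0]) (simp add: Q34_3_def)
  next
    case 4
    define m where "m = nat (6 * n - 17)"
    have m: "int m = 6 * n - 17" unfolding m_def using 4 by simp
    have m6: "[int m = 1] (mod 6)" unfolding m cong_iff_dvd_diff by presburger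
    have "odd m" using m by presburger
    then obtain a b c :: int where "a\<^sup>2 + b\<^sup>2 + c\<^sup>2 = 2 * int m" "gcd a (gcd b c) = 1"
      using primitive_three_squares_twice_odd[of m] by metis
    then obtain Z Y x where 1: "Z\<^sup>2 + 3 * Y\<^sup>2 + 6 * x\<^sup>2 = int m" "(Y, x) \<noteq> (0, 0)"
      using represents_1_3_6_if_three_squares[of a b c "int m"] m6 m 4 by auto
    have "\<not> 3 dvd Z"
    proof
      assume "3 dvd Z"
      hence "3 dvd Z\<^sup>2 + 3 * (Y\<^sup>2 + 2 * x\<^sup>2)" by (simp add: power2_eq_square)
      moreover have "Z\<^sup>2 + 3 * (Y\<^sup>2 + 2 * x\<^sup>2) = int m" using 1(1) by simp
      ultimately have "3 dvd int m" by simp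
      thus False using m by presburger
    qed
    moreover have "even Y \<or> even Z"
    proof (rule ccontr)
      assume "\<not> (even Y \<or> even Z)"
      hence "even (Z\<^sup>2 + 3 * Y\<^sup>2 + 6 * x\<^sup>2)" by simp
      thus False using 1(1) \<open>odd m\<close> by simp
    qed
    ultimately obtain x' Y' Z' where "6 * x'\<^sup>2 + 3 * Y'\<^sup>2 + 4 * Z'\<^sup>2 = 6 * n - 17"
      using represents_3_4_6_if_1_3_6[of Z Y x] 1 m by auto
    then obtain x y w where "Q34_3 x y 1 w = n" using exists_Q34_3_with_z_eq_1 by blast
    thus ?thesis by (intro exI[of _ x] exI[of _ y] exI[of _ 1] exI[of _ w]) simp
  qed
qed

end
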